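(* Let $r>t\ge1$ be integers and $p\ge1$ be a real number. Let $\mathcal{F}$ be a nondegenerate family of $r$-graphs and $\mathfrak{H}$ be a hereditary family of $\mathcal{F}$-free $r$-graphs. Suppose that $\mathcal{F}$ is $(t,p)$-edge-stable and $(t,p)$-vertex-extendable with respect to $\mathfrak{H}$. Then $\mathcal{F}$ is $(t,p)$-degree-stable with respect to $\mathfrak{H}$.
   Context: An $r$-graph $\mathcal{H}$ consists of a finite vertex set $V(\mathcal{H})$ and a collection of $r$-subsets of $V(\mathcal{H})$ (its edges). For a family $\mathcal{F}$ of $r$-graphs, $\mathcal{H}$ is $\mathcal{F}$-free if it contains no member of $\mathcal{F}$ as a (not necessarily induced) subgraph. A family is hereditary if it contains all subgraphs of each of its members. $\mathcal{F}$ is nondegenerate if its Turán density $\pi(\mathcal{F})=\lim_{n\to\infty}\mathrm{ex}(n,\mathcal{F})/\binom{n}{r}$ is positive, where $\mathrm{ex}(n,\mathcal{F})$ is the maximum number of edges of an $n$-vertex $\mathcal{F}$-free $r$-graph. For $T\subset V(\mathcal{H})$, $d_{\mathcal{H}}(T)$ is the number of edges containing $T$. $\|\mathcal{H}\|_{t,p}:=\sum_{T\in\binom{V(\mathcal{H})}{t}}d_{\mathcal{H}}(T)^p$. The $(t,p)$-degree of a vertex $v$ is $\|\mathcal{H}\|_{t,p}-\|\mathcal{H}-v\|_{t,p}$, where $\mathcal{H}-v$ is obtained by removing $v$ and all edges containing it; $\delta_{t,p}(\mathcal{H})$ is the minimum $(t,p)$-degree. $\mathrm{ex}_{t,p}(n,\mathcal{F})$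 is the maximum of $\|\mathcal{H}\|_{t,p}$ over $n$-vertex $\mathcal{F}$-free $r$-graphs, and $\mathrm{exdeg}_{t,p}(n,\mathcal{F}):=(t+p(r-t))\cdot\mathrm{ex}_{t,p}(n,\mathcal{F})/n$. - $\mathcal{F}$ is $(t,p)$-edge-stable with respect to $\mathfrak{H}$ if for every $\delta>0$ there exist $\varepsilon>0$ and $N_0$ such that every $\mathcal{F}$-free $r$-graph $\mathcal{H}$ on $n\ge N_0$ vertices with $\|\mathcal{H}\|_{t,p}\ge(1-\varepsilon)\mathrm{ex}_{t,p}(n,\mathcal{F})$ is in $\mathfrak{H}$ after removing at most $\delta n^r$ edges. - $\mathcal{F}$ is $(t,p)$-degree-stable with respect to $\mathfrak{H}$ if there exist $\varepsilon>0$ and $N_0$ such that every $\mathcal{F}$-free $r$-graph $\mathcal{H}$ on $n\ge N_0$ vertices with $\delta_{t,p}(\mathcal{H})\ge(1-\varepsilon)\mathrm{exdeg}_{t,p}(n,\mathcal{F})$ is in $\mathfrak{H}$. - $\mathcal{F}$ is $(t,p)$-vertex-extendable with respect to $\mathfrak{H}$ if there exist $\varepsilon>0$ and $N_0$ such that for every $\mathcal{F}$-free $r$-graph $\mathcal{H}$ on $n\ge N_0$ vertices with $\delta_{t,p}(\mathcal{H})\ge(1-\varepsilon)\mathrm{exdeg}_{t,p}(n,\mathcal{F})$: if $\mathcal{H}-v\in\mathfrak{H}$ for some $v\in V(\mathcal{H})$, then $\mathcal{H}\in\mathfrak{H}$. *)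

theory Defs
  imports Complex_Main
begin

text \<open>
  Every finite hypergraph is isomorphic to one whose vertices are natural numbers, so
  hypergraphs are taken with vertex sets in \<open>nat\<close>. Graphs are labelled objects and families are
  sets of labelled graphs: no family is required to be closed under isomorphism, but containment
  of a forbidden graph is up to isomorphism.
\<close>

datatype hgraph = HGraph (verts: "nat set") (edges: "nat set set")

definition rgraph :: "nat \<Rightarrow> hgraph \<Rightarrow> bool" where
  "rgraph r H \<longleftrightarrow> finite (verts H) \<and> (\<forall>e\<in>edges H. e \<subseteq> verts H \<and> card e = r)"

definition subgraph :: "hgraph \<Rightarrow> hgraph \<Rightarrow> bool" where
  "subgraph G H \<longleftrightarrow> verts G \<subseteq> verts H \<and> edges G \<subseteq> edges H"

text \<open>\<open>H\<close> has a not necessarily induced subgraph isomorphic to \<open>G\<close>.\<close>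

definition contains_copy :: "hgraph \<Rightarrow> hgraph \<Rightarrow> bool" where
  "contains_copy H G \<longleftrightarrow>
     (\<exists>f. inj_on f (verts G) \<and> f ` verts G \<subseteq> verts H \<and> (\<forall>e\<in>edges G. f ` e \<in> edges H))"

definition free_of :: "hgraph set \<Rightarrow> hgraph \<Rightarrow> bool" where
  "free_of \<F> H \<longleftrightarrow> (\<forall>G\<in>\<F>. \<not> contains_copy H G)"

definition hereditary :: "nat \<Rightarrow> hgraph set \<Rightarrow> bool" where
  "hereditary r \<H> \<longleftrightarrow> (\<forall>H\<in>\<H>. \<forall>G. rgraph r G \<and> subgraph G H \<longrightarrow> G \<in> \<H>)"

definition free_rgraphs :: "nat \<Rightarrow> hgraph set \<Rightarrow> nat \<Rightarrow> hgraph set" where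
  "free_rgraphs r \<F> n = {H. rgraph r H \<and> free_of \<F> H \<and> card (verts H) = n}"

text \<open>
  The set \<open>free_rgraphs r \<F> n\<close> is infinite for \<open>n > 0\<close>, but it has finitely many isomorphism
  classes, so the maxima below are over finite sets of values. These sets are nonempty unless
  some member of \<open>\<F>\<close> has no edges; in that case \<open>ex r \<F> n\<close> is, for all large \<open>n\<close>, the constant
  \<open>Max {}\<close>, and the density is 0 (for \<open>r > 0\<close>).
\<close>

definition ex :: "nat \<Rightarrow> hgraph set \<Rightarrow> nat \<Rightarrow> nat" where
  "ex r \<F> n = Max ((\<lambda>H. card (edges H)) ` free_rgraphs r \<F> n)"

definition turan_density :: "nat \<Rightarrow> hgraph set \<Rightarrow> real" where
  "turan_density r \<F> = lim (\<lambda>n. real (ex r \<F> n) / real (n choose r))"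

definition nondegenerate :: "nat \<Rightarrow> hgraph set \<Rightarrow> bool" where
  "nondegenerate r \<F> \<longleftrightarrow> turan_density r \<F> > 0"

definition deg :: "hgraph \<Rightarrow> nat set \<Rightarrow> nat" where
  "deg H T = card {e \<in> edges H. T \<subseteq> e}"

definition tp_norm :: "nat \<Rightarrow> real \<Rightarrow> hgraph \<Rightarrow> real" where
  "tp_norm t p H = (\<Sum>T | T \<subseteq> verts H \<and> card T = t. real (deg H T) powr p)"

definition del_vertex :: "hgraph \<Rightarrow> nat \<Rightarrow> hgraph" where
  "del_vertex H v = HGraph (verts H - {v}) {e \<in> edges H. v \<notin> e}"

definition tp_degree :: "nat \<Rightarrow> real \<Rightarrow> hgraph \<Rightarrow> nat \<Rightarrow> real" where
  "tp_degree t p H v = tp_norm t p H - tp_norm t p (del_vertex H v)"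

definition min_tp_degree :: "nat \<Rightarrow> real \<Rightarrow> hgraph \<Rightarrow> real" where
  "min_tp_degree t p H = Min (tp_degree t p H ` verts H)"

definition ex_tp :: "nat \<Rightarrow> nat \<Rightarrow> real \<Rightarrow> hgraph set \<Rightarrow> nat \<Rightarrow> real" where
  "ex_tp r t p \<F> n = Max (tp_norm t p ` free_rgraphs r \<F> n)"

definition exdeg_tp :: "nat \<Rightarrow> nat \<Rightarrow> real \<Rightarrow> hgraph set \<Rightarrow> nat \<Rightarrow> real" where
  "exdeg_tp r t p \<F> n =
     (real t + p * (real r - real t)) * ex_tp r t p \<F> n / real n"

definition edge_stable :: "nat \<Rightarrow> nat \<Rightarrow> real \<Rightarrow> hgraph set \<Rightarrow> hgraph set \<Rightarrow> bool" where
  "edge_stable r t p \<F> \<H> \<longleftrightarrow>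
     (\<forall>\<delta>>0. \<exists>\<epsilon>>0. \<exists>N\<^sub>0. \<forall>n\<ge>N\<^sub>0. \<forall>H\<in>free_rgraphs r \<F> n.
        tp_norm t p H \<ge> (1 - \<epsilon>) * ex_tp r t p \<F> n \<longrightarrow>
        (\<exists>D\<subseteq>edges H. real (card D) \<le> \<delta> * real n ^ r \<and> HGraph (verts H) (edges H - D) \<in> \<H>))"

definition degree_stable :: "nat \<Rightarrow> nat \<Rightarrow> real \<Rightarrow> hgraph set \<Rightarrow> hgraph set \<Rightarrow> bool" where
  "degree_stable r t p \<F> \<H> \<longleftrightarrow>
     (\<exists>\<epsilon>>0. \<exists>N\<^sub>0. \<forall>n\<ge>N\<^sub>0. \<forall>H\<in>free_rgraphs r \<F> n.
        min_tp_degree t p H \<ge> (1 - \<epsilon>) * exdeg_tp r t p \<F> n \<longrightarrow> H \<in> \<H>)"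

definition vertex_extendable :: "nat \<Rightarrow> nat \<Rightarrow> real \<Rightarrow> hgraph set \<Rightarrow> hgraph set \<Rightarrow> bool" where
  "vertex_extendable r t p \<F> \<H> \<longleftrightarrow>
     (\<exists>\<epsilon>>0. \<exists>N\<^sub>0. \<forall>n\<ge>N\<^sub>0. \<forall>H\<in>free_rgraphs r \<F> n.
        min_tp_degree t p H \<ge> (1 - \<epsilon>) * exdeg_tp r t p \<F> n \<longrightarrow>
        (\<exists>v\<in>verts H. del_vertex H v \<in> \<H>) \<longrightarrow> H \<in> \<H>)"

end

theory Submission
  imports Defs
begin

text \<open>
  By convexity of the power function, the degrees of an \<open>n\<close>-vertex graph \<open>H\<close> with large minimum
  degree sum to at most a constant times its norm, so edge-stability puts \<open>H\<close> into \<open>\<H>\<close> after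
  deleting a small set \<open>D\<close> of edges. A random subset of large constant size \<open>m\<close> most likely spans
  no edge of \<open>D\<close>, and then its induced subgraph lies in \<open>\<H>\<close>. Now let the subset grow to the whole
  vertex set. A random \<open>k\<close>-subset inherits the minimum degree condition up to a probability
  exponentially small in \<open>k\<close>, because the extremal values, suitably normalized, decrease to a
  positive limit. If it does and its graph is not in \<open>\<H>\<close>, then by vertex-extendability none of
  the graphs obtained by deleting one vertex is. Hence the proportion of \<open>k\<close>-subsets
  outside \<open>\<H>\<close> grows by at most the failure probability at \<open>k\<close>. These are summable, so at
  \<open>k = n\<close> the proportion is still below 1, that is, 0.
\<close>


subsection \<open>Sampling without replacement\<close>

text \<open>For \<open>p > 1\<close> the norm is not linear in the edges, while sampling controls
  only sums over edges with fixed weights. The degree of \<open>v\<close> is therefore caught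
  between two tangent estimates: from above in \<open>H\<close>, with slopes at the full degrees,
  and from below in the sampled graph, with slopes at or below the degrees left after deleting
  \<open>v\<close>. The two differ by a codegree term of relative order \<open>1 / k\<close> and by
  the sampling error, and slopes are uniformly continuous. Failure bounds must depend on
  \<open>k\<close> alone, since \<open>H\<close> may be arbitrarily large. So the union bounds run
  over the points and \<open>t\<close>-subsets of the sample, not over those of the vertex set: such
  a set \<open>A\<close> is drawn first, and the rest of the sample is then uniform in its
  complement. The degree threshold at order \<open>k\<close> involves \<open>exdeg_tp\<close> at
  \<open>k\<close>, not at \<open>n\<close>; after scaling by the complete graph the two differ by a
  ratio of densities, which the positive limit keeps close to 1. The starting size \<open>m\<close>
  is fixed before edge-stability is invoked, because the tolerable number of deleted edges depends
  on \<open>m\<close>.\<close>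

definition ksubsets :: "'a set \<Rightarrow> nat \<Rightarrow> 'a set set" where
  "ksubsets V k = {S. S \<subseteq> V \<and> card S = k}"

lemma ksubsetsD: "finite V \<Longrightarrow> S \<in> ksubsets V k \<Longrightarrow> S \<subseteq> V \<and> card S = k \<and> finite S"
  unfolding ksubsets_def by (auto dest: finite_subset)

lemma card_Diff_ksubsets: "finite V \<Longrightarrow> A \<in> ksubsets V a \<Longrightarrow> card (V - A) = card V - a"
  using ksubsetsD[of V A a] by (auto simp: card_Diff_subset)

lemma finite_ksubsets [simp]: "finite V \<Longrightarrow> finite (ksubsets V k)"
  unfolding ksubsets_def by (rule finite_subset[of _ "Pow V"]) auto

lemma card_ksubsets: "finite V \<Longrightarrow> card (ksubsets V k) = card V choose k"
  unfolding ksubsets_def by (rule n_subsets)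

lemma ksubsets_0: "finite V \<Longrightarrow> ksubsets V 0 = {{}}"
  unfolding ksubsets_def by (auto dest: finite_subset)

lemma sum_ksubsets_insert:
  assumes "finite V" "x \<notin> V"
  shows "(\<Sum>S\<in>ksubsets (insert x V) (Suc k). f S)
    = (\<Sum>S\<in>ksubsets V (Suc k). f S) + (\<Sum>S\<in>ksubsets V k. f (insert x S) :: real)"
proof -
  have "ksubsets (insert x V) (Suc k) = ksubsets V (Suc k) \<union> insert x ` ksubsets V k" (is "?A = ?B")
  proof
    show "?A \<subseteq> ?B"
    proof
      fix S assume S: "S \<in> ?A"
      show "S \<in> ?B"
      proof (cases "x \<in> S")
        case True
        then have "S = insert x (S - {x})" by auto
        moreover have "S - {x} \<in> ksubsets V k"
          using S True assms finite_subset[of S "insert x V"] by (auto simp: ksubsets_def)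
        ultimately show ?thesis by blast
      qed (use S in \<open>auto simp: ksubsets_def\<close>)
    qed
    show "?B \<subseteq> ?A"
      using assms finite_subset[of _ V] by (fastforce simp: ksubsets_def card_insert_if)
  qed
  moreover have "inj_on (insert x) (ksubsets V k)"
    using assms by (auto simp: ksubsets_def inj_on_def)
  moreover have "ksubsets V (Suc k) \<inter> insert x ` ksubsets V k = {}"
    using assms by (auto simp: ksubsets_def)
  ultimately show ?thesis
    using assms by (simp add: sum.union_disjoint sum.reindex)
qed

text \<open>A \<open>k\<close>-set with a marked \<open>a\<close>-subset is the same as an
  \<open>a\<close>-set with a disjoint completion. This exchange lets the marked set be drawn first
  in the union bounds below.\<close>

lemma sum_ksubsets_split:
  assumes "finite V" "a \<le> k"
  shows "(\<Sum>S\<in>ksubsets V k. \<Sum>A\<in>ksubsets S a. f A (S - A))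
    = (\<Sum>A\<in>ksubsets V a. \<Sum>B\<in>ksubsets (V - A) (k - a). (f A B :: real))"
proof -
  have fin: "finite S" if "S \<in> ksubsets V i" for S i
    using that assms by (auto simp: ksubsets_def dest: finite_subset)
  have "(\<Sum>S\<in>ksubsets V k. \<Sum>A\<in>ksubsets S a. f A (S - A))
    = (\<Sum>(S, A)\<in>(SIGMA S:ksubsets V k. ksubsets S a). f A (S - A))"
    using assms fin by (intro sum.Sigma) auto
  also have "\<dots> = (\<Sum>(A, B)\<in>(SIGMA A:ksubsets V a. ksubsets (V - A) (k - a)). f A B)"
  proof (rule sum.reindex_bij_witness[of _ "\<lambda>(A, B). (A \<union> B, A)" "\<lambda>(S, A). (A, S - A)"], goal_cases)
    case (2 SA)
    then obtain S A where SA: "SA = (S, A)" "S \<subseteq> V" "card S = k" "A \<subseteq> S" "card A = a"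
      by (auto simp: ksubsets_def)
    then have "card (S - A) = k - a"
      using card_Diff_subset[of A S] assms finite_subset by metis
    then show ?case using SA by (auto simp: ksubsets_def)
  next
    case (4 AB)
    then obtain A B where AB: "AB = (A, B)" "A \<subseteq> V" "card A = a" "B \<subseteq> V - A" "card B = k - a"
      by (auto simp: ksubsets_def)
    then have "card (A \<union> B) = a + (k - a)"
      using assms finite_subset[of A V] finite_subset[of B V] card_Un_disjoint[of A B] by auto
    then show ?case using AB assms by (auto simp: ksubsets_def)
  qed (auto simp: ksubsets_def)
  also have "\<dots> = (\<Sum>A\<in>ksubsets V a. \<Sum>B\<in>ksubsets (V - A) (k - a). f A B)"
    using assms by (intro sum.Sigma[symmetric]) auto
  finally show ?thesis .
qed

lemma ksubsets_1: "ksubsets S (Suc 0) = (\<lambda>x. {x}) ` S"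
  by (auto simp: ksubsets_def card_Suc_eq)

lemma sum_ksubsets_split_point:
  assumes "finite V" "k > 0"
  shows "(\<Sum>S\<in>ksubsets V k. \<Sum>x\<in>S. f x (S - {x}))
    = (\<Sum>x\<in>V. \<Sum>B\<in>ksubsets (V - {x}) (k - 1). (f x B :: real))"
  using sum_ksubsets_split[of V "Suc 0" k "\<lambda>A. f (the_elem A)"] assms
  by (simp add: ksubsets_1 sum.reindex inj_on_def)

section \<open>Elementary symmetric means and exponential tails for single points\<close>

lemma power_ge_tangent:
  fixes x m :: real
  assumes "x \<ge> 0" "m \<ge> 0"
  shows "x ^ Suc k \<ge> m ^ Suc k + real (Suc k) * m ^ k * (x - m)"
proof (induction k)
  case (Suc k)
  have "x * (m ^ Suc k + real (Suc k) * m ^ k * (x - m)) \<le> x * x ^ Suc k"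
    using Suc assms by (intro mult_left_mono) auto
  moreover have "x * (m ^ Suc k + real (Suc k) * m ^ k * (x - m))
      - (m ^ Suc (Suc k) + real (Suc (Suc k)) * m ^ Suc k * (x - m))
      = real (Suc k) * m ^ k * (x - m)\<^sup>2"
    by (simp add: algebra_simps power2_eq_square)
  moreover have "real (Suc k) * m ^ k * (x - m)\<^sup>2 \<ge> 0" using assms by simp
  ultimately show ?case by (simp del: of_nat_Suc)
qed simp

text \<open>Induction on the point set: splitting on whether the new point is used leaves the
  tangent of the power function at the old mean \<open>m\<close>, evaluated at the new mean
  \<open>m'\<close>. For sampling without replacement this inequality of Maclaurin takes the place
  of independence.\<close>

lemma maclaurin_esym:
  fixes b :: "'a \<Rightarrow> real"
  assumes "finite V" "\<And>x. x \<in> V \<Longrightarrow> b x \<ge> 0"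
  shows "(\<Sum>S\<in>ksubsets V k. \<Prod>x\<in>S. b x) \<le> real (card V choose k) * ((\<Sum>x\<in>V. b x) / real (card V)) ^ k"
  using assms
proof (induction V arbitrary: k rule: finite_induct)
  case empty
  then show ?case by (cases k) (auto simp: ksubsets_0, auto simp: ksubsets_def intro!: sum_nonpos)
next
  case (insert x V)
  define n m where "n = card V" and "m = (\<Sum>y\<in>V. b y) / real n"
  define m' where "m' = (\<Sum>y\<in>insert x V. b y) / real (Suc n)"
  have m0: "m \<ge> 0" "m' \<ge> 0" "b x \<ge> 0"
    using insert(4) by (auto simp: m_def m'_def intro!: sum_nonneg divide_nonneg_nonneg)
  \<comment> \<open>For \<open>n = 0\<close> the quotient \<open>m\<close> is 0 by convention, so
    the identity holds there too.\<close>
  have nm: "real n * m = (\<Sum>y\<in>V. b y)"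
    using insert(1) by (cases "n = 0") (auto simp: m_def n_def)
  have m': "real (Suc n) * (m' - m) = b x - m"
    using insert(1,2) nm by (simp add: m'_def field_simps)
  show ?case
  proof (cases k)
    case 0
    then show ?thesis using insert by (simp add: ksubsets_0)
  next
    case (Suc j)
    have prods: "(\<Prod>y\<in>insert x S. b y) = b x * (\<Prod>y\<in>S. b y)" if "S \<in> ksubsets V j" for S
      using that insert(1,2) finite_subset[of S V] by (subst prod.insert) (auto simp: ksubsets_def)
    have "(\<Sum>S\<in>ksubsets (insert x V) k. \<Prod>y\<in>S. b y)
      = (\<Sum>S\<in>ksubsets V (Suc j). \<Prod>y\<in>S. b y) + b x * (\<Sum>S\<in>ksubsets V j. \<Prod>y\<in>S. b y)"
      unfolding Suc sum_ksubsets_insert[OF insert(1,2)] sum_distrib_left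
      by (simp add: prods cong: sum.cong)
    also have "\<dots> \<le> real (n choose Suc j) * m ^ Suc j + b x * (real (n choose j) * m ^ j)"
      using insert.IH[of "Suc j"] insert.IH[of j] insert.prems m0
      by (intro add_mono mult_left_mono) (auto simp: n_def m_def)
    also have "\<dots> = real (Suc n choose Suc j) * m ^ Suc j + real (n choose j) * m ^ j * (b x - m)"
      by (simp add: algebra_simps)
    also have "real (n choose j) * m ^ j * (b x - m)
        = real (Suc n choose Suc j) * (real (Suc j) * m ^ j * (m' - m))"
    proof -
      have *: "real (Suc n choose Suc j) * real (Suc j) = real (Suc n) * real (n choose j)"
        by (metis Suc_times_binomial_eq of_nat_mult)
      have "real (Suc n choose Suc j) * (real (Suc j) * m ^ j * (m' - m))
          = (real (Suc n choose Suc j) * real (Suc j)) * m ^ j * (m' - m)"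
        by (simp only: mult.assoc)
      also have "\<dots> = real (n choose j) * m ^ j * (real (Suc n) * (m' - m))"
        unfolding * by (simp only: mult_ac)
      finally show ?thesis unfolding m' by (rule sym)
    qed
    also have "real (Suc n choose Suc j) * m ^ Suc j + \<dots>
        = real (Suc n choose Suc j) * (m ^ Suc j + real (Suc j) * m ^ j * (m' - m))"
      by (simp only: distrib_left)
    also have "\<dots> \<le> real (Suc n choose Suc j) * m' ^ Suc j"
      using power_ge_tangent m0 by (intro mult_left_mono) auto
    finally show ?thesis using insert(1,2) Suc by (simp add: n_def m'_def)
  qed
qed

text \<open>The right-hand side is nonnegative, and its product with the quadratic lower bound for
  \<open>exp y\<close> is \<open>1 + y^4 / 4\<close>, hence at least 1.\<close>

lemma exp_minus_le_quadratic:
  fixes y :: real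
  assumes "y \<ge> 0"
  shows "exp (- y) \<le> 1 - y + y\<^sup>2 / 2"
proof -
  have l: "1 + y + y\<^sup>2 / 2 \<le> exp y" using exp_lower_Taylor_quadratic[OF assms] .
  have "0 \<le> (1 - y)\<^sup>2" by simp
  then have q: "0 \<le> 1 - y + y\<^sup>2 / 2" by (simp add: power2_eq_square algebra_simps)
  have "1 \<le> 1 + (y\<^sup>2)\<^sup>2 / 4" by simp
  also have "\<dots> = (1 - y + y\<^sup>2 / 2) * (1 + y + y\<^sup>2 / 2)"
    by (simp add: power2_eq_square algebra_simps)
  also have "\<dots> \<le> (1 - y + y\<^sup>2 / 2) * exp y"
    using l q by (intro mult_left_mono) auto
  finally show ?thesis by (simp add: exp_minus field_simps)
qed

text \<open>Chernoff's argument with exponential parameter \<open>\<eta>\<close> itself: Maclaurin's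
  inequality bounds the exponential moment of a sample by the one of independent draws, and the
  exponents then add up to \<open>- (\<eta>^2 * k / 2)\<close>.\<close>

lemma hoeffding_ksubsets:
  fixes a :: "'a \<Rightarrow> real"
  assumes "finite V" "\<And>x. x \<in> V \<Longrightarrow> 0 \<le> a x \<and> a x \<le> 1" "\<eta> \<ge> 0"
  shows "real (card {S \<in> ksubsets V k. (\<Sum>x\<in>S. a x) < real k * ((\<Sum>x\<in>V. a x) / real (card V) - \<eta>)})
    \<le> real (card V choose k) * exp (- (\<eta>\<^sup>2 * real k / 2))"
proof (cases "V = {}")
  case True
  then have "{S \<in> ksubsets V k. (\<Sum>x\<in>S. a x) < real k * ((\<Sum>x\<in>V. a x) / real (card V) - \<eta>)} = {}"
    using assms(3) by (auto simp: ksubsets_def mult_less_0_iff)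
  then show ?thesis by (simp only: card.empty) simp
next
  case False
  define n \<mu> where "n = card V" and "\<mu> = (\<Sum>x\<in>V. a x) / real n"
  define F where "F = {S \<in> ksubsets V k. (\<Sum>x\<in>S. a x) < real k * (\<mu> - \<eta>)}"
  define b where "b = (\<lambda>x. exp (- (\<eta> * a x)))"
  have n: "n > 0" using False assms by (auto simp: n_def card_gt_0_iff)
  have "(\<Sum>x\<in>V. b x) \<le> (\<Sum>x\<in>V. 1 - \<eta> * a x + \<eta>\<^sup>2 / 2)"
  proof (rule sum_mono)
    fix x assume "x \<in> V"
    then have a: "0 \<le> a x" "a x \<le> 1" using assms by auto
    have "b x \<le> 1 - \<eta> * a x + (\<eta> * a x)\<^sup>2 / 2"
      unfolding b_def using a assms by (intro exp_minus_le_quadratic) auto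
    also have "(\<eta> * a x)\<^sup>2 \<le> \<eta>\<^sup>2"
      using a assms(3) by (intro power_mono) (auto simp: mult_left_le)
    finally show "b x \<le> 1 - \<eta> * a x + \<eta>\<^sup>2 / 2" by simp
  qed
  also have "\<dots> = real n * (1 - \<eta> * \<mu> + \<eta>\<^sup>2 / 2)"
    using n by (simp add: sum.distrib sum_subtractf \<mu>_def n_def sum_distrib_left[symmetric] algebra_simps)
  finally have "(\<Sum>x\<in>V. b x) / real n \<le> 1 + (\<eta>\<^sup>2 / 2 - \<eta> * \<mu>)"
    using n by (simp add: field_simps)
  also have "\<dots> \<le> exp (\<eta>\<^sup>2 / 2 - \<eta> * \<mu>)" by (rule exp_ge_add_one_self)
  finally have mean: "(\<Sum>x\<in>V. b x) / real n \<le> exp (\<eta>\<^sup>2 / 2 - \<eta> * \<mu>)" .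
  have "real (card F) * exp (- (\<eta> * (real k * (\<mu> - \<eta>)))) = (\<Sum>S\<in>F. exp (- (\<eta> * (real k * (\<mu> - \<eta>)))))"
    by simp
  also have "\<dots> \<le> (\<Sum>S\<in>F. \<Prod>x\<in>S. b x)"
  proof (rule sum_mono)
    fix S assume S: "S \<in> F"
    then have "finite S" using assms by (auto simp: F_def ksubsets_def dest: finite_subset)
    then have "(\<Prod>x\<in>S. b x) = exp (- (\<eta> * (\<Sum>x\<in>S. a x)))"
      by (simp add: b_def exp_sum sum_distrib_left sum_negf[symmetric])
    moreover have "\<eta> * (\<Sum>x\<in>S. a x) \<le> \<eta> * (real k * (\<mu> - \<eta>))"
      using S assms by (intro mult_left_mono) (auto simp: F_def)
    ultimately show "exp (- (\<eta> * (real k * (\<mu> - \<eta>)))) \<le> (\<Prod>x\<in>S. b x)" by simp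
  qed
  also have "\<dots> \<le> (\<Sum>S\<in>ksubsets V k. \<Prod>x\<in>S. b x)"
    using assms by (intro sum_mono2) (auto simp: F_def b_def prod_nonneg)
  also have "\<dots> \<le> real (n choose k) * ((\<Sum>x\<in>V. b x) / real n) ^ k"
    unfolding n_def using assms by (intro maclaurin_esym) (auto simp: b_def)
  also have "\<dots> \<le> real (n choose k) * exp (\<eta>\<^sup>2 / 2 - \<eta> * \<mu>) ^ k"
    using mean n by (intro mult_left_mono power_mono) (auto simp: b_def intro!: sum_nonneg divide_nonneg_nonneg)
  also have "\<dots> = real (n choose k) * exp (real k * (\<eta>\<^sup>2 / 2 - \<eta> * \<mu>))"
    by (simp add: exp_of_nat_mult)
  finally have "real (card F) * exp (- (\<eta> * (real k * (\<mu> - \<eta>)))) * exp (\<eta> * (real k * (\<mu> - \<eta>)))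
     \<le> real (n choose k) * exp (real k * (\<eta>\<^sup>2 / 2 - \<eta> * \<mu>)) * exp (\<eta> * (real k * (\<mu> - \<eta>)))"
    by (intro mult_right_mono) auto
  then have "real (card F) \<le> real (n choose k) * exp (real k * (\<eta>\<^sup>2 / 2 - \<eta> * \<mu>) + \<eta> * (real k * (\<mu> - \<eta>)))"
    by (simp add: mult.assoc exp_add[symmetric])
  also have "real k * (\<eta>\<^sup>2 / 2 - \<eta> * \<mu>) + \<eta> * (real k * (\<mu> - \<eta>)) = - (\<eta>\<^sup>2 * real k / 2)"
    by (simp add: power2_eq_square algebra_simps)
  finally show ?thesis by (simp add: F_def n_def \<mu>_def)
qed


section \<open>Lower tails for weighted sums over the subsets of a sample\<close>

lemma sum_link:
  fixes w :: "'a set \<Rightarrow> real"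
  assumes "finite S"
  shows "(\<Sum>x\<in>S. \<Sum>B\<in>ksubsets (S - {x}) j. w (insert x B)) = real (Suc j) * (\<Sum>A\<in>ksubsets S (Suc j). w A)"
proof -
  have "(\<Sum>A\<in>ksubsets S (Suc j). \<Sum>x\<in>A. w (insert x (A - {x}))) = (\<Sum>A\<in>ksubsets S (Suc j). real (Suc j) * w A)"
    by (intro sum.cong refl) (auto simp: ksubsets_def insert_absorb)
  then show ?thesis
    using sum_ksubsets_split_point[OF assms, of "Suc j" "\<lambda>x B. w (insert x B)"]
    by (simp add: sum_distrib_left)
qed

lemma sum_ksubsets_bounds:
  fixes w :: "'a set \<Rightarrow> real"
  assumes "finite V" "\<And>A. A \<in> ksubsets V j \<Longrightarrow> 0 \<le> w A \<and> w A \<le> 1"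
  shows "0 \<le> sum w (ksubsets V j) / real (card V choose j) \<and> sum w (ksubsets V j) / real (card V choose j) \<le> 1"
proof -
  have "sum w (ksubsets V j) \<le> real (card V choose j) * 1"
    unfolding card_ksubsets[OF assms(1), symmetric] using assms(2) by (intro sum_bounded_above) auto
  moreover have "0 \<le> sum w (ksubsets V j)" using assms by (intro sum_nonneg) auto
  ultimately show ?thesis by (auto simp: divide_le_eq)
qed

text \<open>For \<open>k > n\<close> both sides vanish, so the counting arguments need no case
  distinction on the sample size.\<close>

lemma choose_times_choose:
  assumes "a \<le> k"
  shows "(n choose a) * ((n - a) choose (k - a)) = (n choose k) * (k choose a)"
proof (cases "k \<le> n")
  case True
  then show ?thesis using choose_mult[OF assms True] by simp
next
  case False
  then have "n choose k = 0" by (simp add: binomial_eq_0_iff)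
  moreover have "n choose a = 0 \<or> (n - a) choose (k - a) = 0"
    using False assms by (auto simp: binomial_eq_0_iff)
  ultimately show ?thesis by (elim disjE) (simp_all only: mult_zero_left mult_zero_right)
qed

text \<open>Union bound over the \<open>a\<close>-subsets of the sample. With \<open>A\<close> drawn
  first, \<open>S - A\<close> is uniform among the \<open>(k - a)\<close>-subsets of
  \<open>V - A\<close>; the price is \<open>k choose a\<close>, which is free of
  \<open>card V\<close>.\<close>

lemma card_ksubsets_split_le:
  assumes "finite V" "a \<le> k"
    and "\<And>A. A \<in> ksubsets V a \<Longrightarrow> real (card (F A)) \<le> real ((card V - a) choose (k - a)) * \<tau>"
    and "\<And>A. A \<in> ksubsets V a \<Longrightarrow> F A \<subseteq> ksubsets (V - A) (k - a)"
  shows "real (card {S \<in> ksubsets V k. \<exists>A\<in>ksubsets S a. S - A \<in> F A})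
    \<le> real (card V choose k) * (real (k choose a) * \<tau>)"
proof -
  have "real (card {S \<in> ksubsets V k. \<exists>A\<in>ksubsets S a. S - A \<in> F A})
      = (\<Sum>S\<in>ksubsets V k. of_bool (\<exists>A\<in>ksubsets S a. S - A \<in> F A))"
    using assms(1) by (simp add: sum_of_bool_eq Int_def)
  also have "\<dots> \<le> (\<Sum>S\<in>ksubsets V k. \<Sum>A\<in>ksubsets S a. of_bool (S - A \<in> F A))"
  proof (rule sum_mono)
    fix S assume "S \<in> ksubsets V k"
    then have "finite S" using assms(1) by (auto simp: ksubsets_def dest: finite_subset)
    then have fin: "finite (ksubsets S a)" by simp
    show "of_bool (\<exists>A\<in>ksubsets S a. S - A \<in> F A) \<le> (\<Sum>A\<in>ksubsets S a. of_bool (S - A \<in> F A) :: real)"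
    proof (cases "\<exists>A\<in>ksubsets S a. S - A \<in> F A")
      case True
      then obtain A where A: "A \<in> ksubsets S a" "S - A \<in> F A" by blast
      then have "(1 :: real) = of_bool (S - A \<in> F A)" by simp
      also have "\<dots> \<le> (\<Sum>A\<in>ksubsets S a. of_bool (S - A \<in> F A))"
        using fin A by (intro member_le_sum) auto
      finally show ?thesis using True by simp
    qed (simp add: sum_nonneg)
  qed
  also have "\<dots> = (\<Sum>A\<in>ksubsets V a. \<Sum>B\<in>ksubsets (V - A) (k - a). of_bool (B \<in> F A))"
    by (rule sum_ksubsets_split[OF assms(1,2)])
  also have "\<dots> = (\<Sum>A\<in>ksubsets V a. real (card (F A)))"
  proof (intro sum.cong refl)
    fix A assume "A \<in> ksubsets V a"
    then have "ksubsets (V - A) (k - a) \<inter> {B. B \<in> F A} = F A" using assms(4) by auto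
    then show "(\<Sum>B\<in>ksubsets (V - A) (k - a). of_bool (B \<in> F A)) = real (card (F A))"
      using assms(1) by (simp add: sum_of_bool_eq)
  qed
  also have "\<dots> \<le> (\<Sum>A\<in>ksubsets V a. real ((card V - a) choose (k - a)) * \<tau>)"
    using assms(3) by (rule sum_mono)
  also have "\<dots> = real ((card V choose a) * ((card V - a) choose (k - a))) * \<tau>"
    using assms(1) by (simp add: card_ksubsets)
  also have "\<dots> = real (card V choose k) * (real (k choose a) * \<tau>)"
    unfolding choose_times_choose[OF assms(2)] by simp
  finally show ?thesis .
qed

lemma card_ksubsets_point_le:
  assumes "finite V" "k > 0"
    and "\<And>x. x \<in> V \<Longrightarrow> real (card (F x)) \<le> real ((card V - 1) choose (k - 1)) * \<tau>"
    and "\<And>x. x \<in> V \<Longrightarrow> F x \<subseteq> ksubsets (V - {x}) (k - 1)"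
  shows "real (card {S \<in> ksubsets V k. \<exists>x\<in>S. S - {x} \<in> F x}) \<le> real (card V choose k) * (real k * \<tau>)"
proof -
  have "real (card {S \<in> ksubsets V k. \<exists>A\<in>ksubsets S 1. S - A \<in> F (the_elem A)})
    \<le> real (card V choose k) * (real (k choose 1) * \<tau>)"
  proof (rule card_ksubsets_split_le)
    fix A assume "A \<in> ksubsets V 1"
    then obtain x where "x \<in> V" "A = {x}" by (auto simp: ksubsets_1)
    then show "real (card (F (the_elem A))) \<le> real ((card V - 1) choose (k - 1)) * \<tau>"
      and "F (the_elem A) \<subseteq> ksubsets (V - A) (k - 1)"
      using assms(3,4)[of x] by auto
  qed (use assms in auto)
  then show ?thesis by (simp add: ksubsets_1)
qed

text \<open>A \<open>j\<close>-subset is revealed one point at a time: the link of each sampled point is in turn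
  sampled by the remaining points, at the price of a union bound over the points.\<close>

lemma sampling_lower_tail:
  fixes w :: "'a set \<Rightarrow> real"
  assumes "finite V" "\<And>A. A \<in> ksubsets V j \<Longrightarrow> 0 \<le> w A \<and> w A \<le> 1" "\<eta> \<ge> 0"
  shows "real (card {S \<in> ksubsets V k. (\<Sum>A\<in>ksubsets S j. w A)
      < ((\<Sum>A\<in>ksubsets V j. w A) / real (card V choose j) - real j * \<eta>) * real (k choose j)})
    \<le> real (card V choose k) * ((1 + real k) ^ j * exp (- (\<eta>\<^sup>2 * (real k - real j) / 2)))"
  using assms
proof (induction j arbitrary: V k w)
  case 0
  have "{S \<in> ksubsets V k. (\<Sum>A\<in>ksubsets S 0. w A)
      < ((\<Sum>A\<in>ksubsets V 0. w A) / real (card V choose 0) - real 0 * \<eta>) * real (k choose 0)} = {}"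
  proof -
    have "ksubsets S 0 = ksubsets V 0" if "S \<in> ksubsets V k" for S
      using that 0(1) ksubsets_0[of S] ksubsets_0[of V] finite_subset[of S V] by (auto simp: ksubsets_def[of V k])
    then show ?thesis by auto
  qed
  then show ?case by (simp only: card.empty) simp
next
  case (Suc j)
  define n where "n = card V"
  define D where "D = (\<Sum>A\<in>ksubsets V (Suc j). w A) / real (n choose Suc j)"
  define W where "W = (\<lambda>x B. w (insert x B))"
  \<comment> \<open>The density of the link of \<open>x\<close>, which serves as the point weight in
    the Hoeffding bound.\<close>
  define m where "m = (\<lambda>x. (\<Sum>B\<in>ksubsets (V - {x}) j. W x B) / real ((n - 1) choose j))"
  define F where "F = {S \<in> ksubsets V k. (\<Sum>A\<in>ksubsets S (Suc j). w A) < (D - real (Suc j) * \<eta>) * real (k choose Suc j)}"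
  show ?case
  proof (cases "k = 0")
    case True
    moreover have "ksubsets {} (Suc j) = ({} :: 'a set set)" by (auto simp: ksubsets_def)
    ultimately have "F = {}" using Suc.prems(1) by (auto simp: F_def ksubsets_0)
    then show ?thesis unfolding F_def D_def n_def by (simp only: card.empty) simp
  next
    case k: False
    define \<tau> where "\<tau> = (1 + real (k - 1)) ^ j * exp (- (\<eta>\<^sup>2 * (real (k - 1) - real j) / 2))"
    \<comment> \<open>There are two ways to fail: the sampled points have link densities with too
      small a mean (\<open>B1\<close>), or the link of some sampled point is undersampled by the
      other points (\<open>B2\<close>). The first costs one \<open>\<eta>\<close>, the second
      \<open>j\<close> of them.\<close>
    define B1 where "B1 = {S \<in> ksubsets V k. (\<Sum>x\<in>S. m x) < real k * ((\<Sum>x\<in>V. m x) / real n - \<eta>)}"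
    define L where "L = (\<lambda>x. {S \<in> ksubsets (V - {x}) (k - 1). (\<Sum>B\<in>ksubsets S j. W x B) < (m x - real j * \<eta>) * real ((k - 1) choose j)})"
    define B2 where "B2 = {S \<in> ksubsets V k. \<exists>x\<in>S. S - {x} \<in> L x}"
    have W01: "0 \<le> W x B \<and> W x B \<le> 1" if "x \<in> V" "B \<in> ksubsets (V - {x}) j" for x B
    proof -
      have "finite B" using that Suc.prems(1) by (auto simp: ksubsets_def dest: finite_subset)
      moreover have "x \<notin> B" using that by (auto simp: ksubsets_def)
      ultimately have "insert x B \<in> ksubsets V (Suc j)"
        using that by (auto simp: ksubsets_def)
      then show ?thesis unfolding W_def using Suc.prems(2) by blast
    qed
    have cV: "card (V - {x}) = n - 1" if "x \<in> V" for x using that by (simp add: n_def)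
    have m01: "0 \<le> m x \<and> m x \<le> 1" if "x \<in> V" for x
      using sum_ksubsets_bounds[of "V - {x}" j "W x"] W01[OF that] Suc.prems(1) cV[OF that]
      by (simp add: m_def)
    have c1: "real (card B1) \<le> real (n choose k) * exp (- (\<eta>\<^sup>2 * real k / 2))"
      unfolding B1_def n_def by (rule hoeffding_ksubsets) (use Suc.prems m01 in auto)
    have cL: "real (card (L x)) \<le> real ((n - 1) choose (k - 1)) * \<tau>" if "x \<in> V" for x
      using Suc.IH[of "V - {x}" "W x" "k - 1"] Suc.prems W01[OF that] cV[OF that]
      by (simp add: L_def m_def \<tau>_def)
    have c2: "real (card B2) \<le> real (n choose k) * (real k * \<tau>)"
      unfolding B2_def n_def
      by (rule card_ksubsets_point_le) (use Suc.prems k cL in \<open>auto simp: n_def L_def\<close>)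
    have n0: "n > 0" if "S \<in> ksubsets V k" for S
      using that k Suc.prems(1) by (auto simp: ksubsets_def n_def card_gt_0_iff)
    have "F \<subseteq> B1 \<union> B2"
    proof
      fix S assume S: "S \<in> F"
      then have Sk: "S \<in> ksubsets V k" and finS: "finite S"
        using Suc.prems(1) by (auto simp: F_def ksubsets_def dest: finite_subset)
      show "S \<in> B1 \<union> B2"
      proof (rule ccontr)
        assume neg: "S \<notin> B1 \<union> B2"
        have n: "n > 0" using n0[OF Sk] .
        have "(\<Sum>x\<in>V. m x) = (\<Sum>x\<in>V. \<Sum>B\<in>ksubsets (V - {x}) j. W x B) / real ((n - 1) choose j)"
          by (simp add: m_def sum_divide_distrib)
        also have "\<dots> = real (Suc j) * (\<Sum>A\<in>ksubsets V (Suc j). w A) / real ((n - 1) choose j)"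
          unfolding W_def by (simp only: sum_link[OF Suc.prems(1)])
        finally have mm: "(\<Sum>x\<in>V. m x) = real (Suc j) * (\<Sum>A\<in>ksubsets V (Suc j). w A) / real ((n - 1) choose j)" .
        have "Suc j * (n choose Suc j) = n * ((n - 1) choose j)"
          using times_binomial_minus1_eq[of "Suc j" n] by simp
        then have b: "real (Suc j) * real (n choose Suc j) = real n * real ((n - 1) choose j)"
          by (metis of_nat_mult)
        \<comment> \<open>By double counting, the mean link density is the density itself. If the
          condition fails, then \<open>(k - 1) choose j\<close> is 0 as well, because
          \<open>k \<le> n\<close>, and the estimate that uses this identity is trivial.\<close>
        have D: "(\<Sum>x\<in>V. m x) / real n = D" if "(n - 1) choose j \<noteq> 0"
        proof -
          have "n choose Suc j \<noteq> 0" using b that n by auto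
          then show ?thesis using b that n unfolding mm D_def
            by (simp del: of_nat_Suc binomial_Suc_Suc add: field_simps)
        qed
        have kb: "real (Suc j) * real (k choose Suc j) = real k * real ((k - 1) choose j)"
          using times_binomial_minus1_eq[of "Suc j" k] by (metis of_nat_mult diff_Suc_1 zero_less_Suc)
        have "(D - real (Suc j) * \<eta>) * real (k choose Suc j) * real (Suc j)
            = (real k * (D - \<eta>) - real k * (real j * \<eta>)) * real ((k - 1) choose j)"
        proof -
          have "(D - real (Suc j) * \<eta>) * real (k choose Suc j) * real (Suc j)
            = (D - real (Suc j) * \<eta>) * (real k * real ((k - 1) choose j))"
            by (simp only: kb[symmetric] mult_ac)
          then show ?thesis by (simp add: algebra_simps)
        qed
        also have "\<dots> \<le> ((\<Sum>x\<in>S. m x) - real k * (real j * \<eta>)) * real ((k - 1) choose j)"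
        proof (cases "(k - 1) choose j = 0")
          case False
          then have "k \<le> n" "j \<le> k - 1"
            using Sk Suc.prems(1) by (auto simp: n_def ksubsets_def card_mono binomial_eq_0_iff not_less)
          then have "(n - 1) choose j \<noteq> 0" by (simp add: binomial_eq_0_iff)
          then show ?thesis using D neg Sk by (intro mult_right_mono) (auto simp: B1_def)
        next
          case True
          then show ?thesis by (simp only: of_nat_0 mult_zero_right order_refl)
        qed
        also have "\<dots> = (\<Sum>x\<in>S. (m x - real j * \<eta>) * real ((k - 1) choose j))"
          using Sk by (simp add: sum_distrib_right[symmetric] sum_subtractf ksubsets_def)
        also have "\<dots> \<le> (\<Sum>x\<in>S. \<Sum>B\<in>ksubsets (S - {x}) j. W x B)"
        proof (rule sum_mono)
          fix x assume x: "x \<in> S"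
          then have "S - {x} \<in> ksubsets (V - {x}) (k - 1)"
            using Sk finS by (auto simp: ksubsets_def)
          moreover have "S - {x} \<notin> L x" using neg x Sk by (auto simp: B2_def)
          ultimately show "(m x - real j * \<eta>) * real ((k - 1) choose j) \<le> (\<Sum>B\<in>ksubsets (S - {x}) j. W x B)"
            by (auto simp: L_def)
        qed
        also have "\<dots> = real (Suc j) * (\<Sum>A\<in>ksubsets S (Suc j). w A)"
          unfolding W_def by (rule sum_link[OF finS])
        finally have "(D - real (Suc j) * \<eta>) * real (k choose Suc j) \<le> (\<Sum>A\<in>ksubsets S (Suc j). w A)"
          by (simp only: mult.commute[of _ "real (Suc j)"] mult_le_cancel_left_pos of_nat_0_less_iff zero_less_Suc)
        then show False using S by (auto simp: F_def)
      qed
    qed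
    moreover have "finite (B1 \<union> B2)" using Suc.prems(1) by (simp add: B1_def B2_def)
    ultimately have "card F \<le> card (B1 \<union> B2)" by (intro card_mono)
    also have "\<dots> \<le> card B1 + card B2" by (rule card_Un_le)
    finally have "real (card F) \<le> real (card B1) + real (card B2)" by simp
    also have "\<dots> \<le> real (n choose k) * (exp (- (\<eta>\<^sup>2 * real k / 2)) + real k * \<tau>)"
      using c1 c2 by (simp add: distrib_left)
    also have "\<dots> \<le> real (n choose k) * ((1 + real k) ^ Suc j * exp (- (\<eta>\<^sup>2 * (real k - real (Suc j)) / 2)))"
    proof (rule mult_left_mono)
      \<comment> \<open>The pairs \<open>k - 1\<close>, \<open>j\<close> and \<open>k\<close>,
        \<open>Suc j\<close> have the same difference, so the link term carries exactly this
        exponential; only the polynomial factors have to be merged.\<close>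
      define E where "E = exp (- (\<eta>\<^sup>2 * (real k - real (Suc j)) / 2))"
      have "exp (- (\<eta>\<^sup>2 * real k / 2)) \<le> E"
        unfolding E_def using mult_left_mono[of "real k - real (Suc j)" "real k" "\<eta>\<^sup>2"] by (auto simp del: of_nat_Suc)
      moreover have "\<tau> = real k ^ j * E" using k by (simp add: \<tau>_def E_def of_nat_diff algebra_simps)
      ultimately have "exp (- (\<eta>\<^sup>2 * real k / 2)) + real k * \<tau> \<le> (1 + real k * real k ^ j) * E"
        by (simp add: algebra_simps)
      also have "\<dots> \<le> (1 + real k) ^ Suc j * E"
      proof (rule mult_right_mono)
        have "1 + real k * real k ^ j \<le> (1 + real k) ^ j + real k * (1 + real k) ^ j"
          by (intro add_mono mult_left_mono power_mono one_le_power) auto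
        then show "1 + real k * real k ^ j \<le> (1 + real k) ^ Suc j" by (simp add: algebra_simps)
      qed (simp add: E_def)
      finally show "exp (- (\<eta>\<^sup>2 * real k / 2)) + real k * \<tau> \<le> (1 + real k) ^ Suc j * E" .
    qed simp
    finally show ?thesis unfolding F_def D_def n_def .
  qed
qed

lemma sampling_link_lower_tail:
  fixes w :: "'a set \<Rightarrow> 'a set \<Rightarrow> real"
  assumes "finite V" "a \<le> k" "\<eta> \<ge> 0"
    and "\<And>A B. A \<in> ksubsets V a \<Longrightarrow> B \<in> ksubsets (V - A) j \<Longrightarrow> 0 \<le> w A B \<and> w A B \<le> 1"
  shows "real (card {S \<in> ksubsets V k. \<exists>A\<in>ksubsets S a. (\<Sum>B\<in>ksubsets (S - A) j. w A B)
      < ((\<Sum>B\<in>ksubsets (V - A) j. w A B) / real ((card V - a) choose j) - real j * \<eta>) * real ((k - a) choose j)})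
    \<le> real (card V choose k) * (real (k choose a) *
        ((1 + real (k - a)) ^ j * exp (- (\<eta>\<^sup>2 * (real (k - a) - real j) / 2))))"
proof -
  define F where "F = (\<lambda>A. {S \<in> ksubsets (V - A) (k - a). (\<Sum>B\<in>ksubsets S j. w A B)
      < ((\<Sum>B\<in>ksubsets (V - A) j. w A B) / real ((card V - a) choose j) - real j * \<eta>) * real ((k - a) choose j)})"
  have "card (V - A) = card V - a" if "A \<in> ksubsets V a" for A
    using that assms(1) by (simp add: card_Diff_ksubsets)
  then have "real (card (F A)) \<le> real ((card V - a) choose (k - a)) *
      ((1 + real (k - a)) ^ j * exp (- (\<eta>\<^sup>2 * (real (k - a) - real j) / 2)))"
    if "A \<in> ksubsets V a" for A
    using sampling_lower_tail[of "V - A" j "w A" \<eta> "k - a"] assms that by (simp add: F_def)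
  then have "real (card {S \<in> ksubsets V k. \<exists>A\<in>ksubsets S a. S - A \<in> F A})
    \<le> real (card V choose k) * (real (k choose a) *
        ((1 + real (k - a)) ^ j * exp (- (\<eta>\<^sup>2 * (real (k - a) - real j) / 2))))"
    using assms by (intro card_ksubsets_split_le) (auto simp: F_def)
  moreover have "{S \<in> ksubsets V k. \<exists>A\<in>ksubsets S a. (\<Sum>B\<in>ksubsets (S - A) j. w A B)
      < ((\<Sum>B\<in>ksubsets (V - A) j. w A B) / real ((card V - a) choose j) - real j * \<eta>) * real ((k - a) choose j)}
    = {S \<in> ksubsets V k. \<exists>A\<in>ksubsets S a. S - A \<in> F A}"
  proof (intro Collect_cong conj_cong bex_cong refl)
    fix S A assume "S \<in> ksubsets V k" "A \<in> ksubsets S a"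
    moreover from calculation have "finite S" "S \<subseteq> V" "card S = k"
      using ksubsetsD[OF assms(1)] by blast+
    moreover from calculation have "card (S - A) = k - a" by (simp add: card_Diff_ksubsets)
    ultimately have "S - A \<in> ksubsets (V - A) (k - a)" by (auto simp: ksubsets_def)
    then show "((\<Sum>B\<in>ksubsets (S - A) j. w A B)
      < ((\<Sum>B\<in>ksubsets (V - A) j. w A B) / real ((card V - a) choose j) - real j * \<eta>) * real ((k - a) choose j))
      = (S - A \<in> F A)" by (simp add: F_def)
  qed
  ultimately show ?thesis by simp
qed


subsection \<open>Linearized degrees\<close>

text \<open>The derivative of \<open>z powr p\<close> without its factor \<open>p\<close>. The case
  \<open>p = 1\<close> is separate because \<open>0 powr 0 = 0\<close> would make the slope jump at
  0, and uniform continuity is needed later.\<close>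

definition powr_slope :: "real \<Rightarrow> real \<Rightarrow> real" where
  "powr_slope p z = (if p = 1 then 1 else z powr (p - 1))"

lemma powr_slope_nonneg: "powr_slope p z \<ge> 0"
  by (simp add: powr_slope_def)

lemma powr_slope_mono: "p \<ge> 1 \<Longrightarrow> 0 \<le> x \<Longrightarrow> x \<le> y \<Longrightarrow> powr_slope p x \<le> powr_slope p y"
  by (auto simp: powr_slope_def intro: powr_mono2)

lemma powr_slope_le_1: "p \<ge> 1 \<Longrightarrow> 0 \<le> x \<Longrightarrow> x \<le> 1 \<Longrightarrow> powr_slope p x \<le> 1"
  using powr_slope_mono[of p x 1] by (simp add: powr_slope_def split: if_splits)

lemma powr_slope_mult: "0 \<le> x \<Longrightarrow> 0 \<le> y \<Longrightarrow> powr_slope p (x * y) = powr_slope p x * powr_slope p y"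
  by (simp add: powr_slope_def powr_mult)

lemma powr_eq_mult_slope: "x \<ge> 0 \<Longrightarrow> x powr p = x * powr_slope p x"
  by (cases "x = 0") (auto simp: powr_slope_def powr_diff)

text \<open>If the left side \<open>B\<close> is positive, compare logarithms, using
  \<open>ln y \<le> y - 1\<close> at \<open>y = B / s\<close> and again at
  \<open>y = 1 / s\<close>.\<close>

lemma bernoulli_powr:
  fixes s p :: real
  assumes "s > 0" "p \<ge> 1"
  shows "1 + p * (s - 1) \<le> s powr p"
proof (cases "1 + p * (s - 1) > 0")
  case True
  define B where "B = 1 + p * (s - 1)"
  have "ln B - ln s = ln (B / s)" using True assms by (simp add: B_def ln_div)
  also have "\<dots> \<le> B / s - 1" using True assms by (intro ln_le_minus_one) (simp add: B_def)
  also have "\<dots> = (p - 1) * (1 - 1 / s)" using assms by (simp add: B_def field_simps)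
  also have "\<dots> \<le> (p - 1) * ln s"
    using ln_le_minus_one[of "1 / s"] assms by (intro mult_left_mono) (auto simp: ln_div)
  finally have "ln B \<le> p * ln s" by (simp add: algebra_simps)
  then have "exp (ln B) \<le> exp (p * ln s)" by simp
  then show ?thesis using True assms by (simp add: B_def powr_def)
next
  case False
  then show ?thesis using powr_ge_zero[of s p] by linarith
qed

text \<open>Bernoulli's inequality at the ratio \<open>x / y\<close>, scaled by
  \<open>y powr p\<close>. Convexity of the norm is always used in this form.\<close>

lemma powr_ge_tangent:
  fixes x y p :: real
  assumes "x \<ge> 0" "y \<ge> 0" "p \<ge> 1"
  shows "y powr p + p * powr_slope p y * (x - y) \<le> x powr p"
proof (cases "p = 1")
  case False
  show ?thesis
  proof (cases "y = 0")
    case True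
    then show ?thesis using False assms by (simp add: powr_slope_def)
  next
    case y: False
    show ?thesis
    proof (cases "x = 0")
      case True
      have "1 * y powr p \<le> p * y powr p" using assms by (intro mult_right_mono) auto
      then show ?thesis using True y assms powr_eq_mult_slope[of y p] by (simp add: mult_ac)
    next
      case x: False
      have "y powr p * (1 + p * (x / y - 1)) \<le> y powr p * (x / y) powr p"
        using x y assms by (intro mult_left_mono bernoulli_powr) auto
      also have "\<dots> = x powr p" using x y assms by (simp add: powr_divide)
      finally have "y powr p * (1 + p * (x / y - 1)) \<le> x powr p" .
      moreover have "powr_slope p y = y powr p / y" using y assms powr_eq_mult_slope[of y p] by simp
      then have "y powr p + p * powr_slope p y * (x - y) = y powr p * (1 + p * (x / y - 1))"
        using y by (simp add: field_simps)
      ultimately show ?thesis by simp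
    qed
  qed
qed (use assms in \<open>simp add: powr_slope_def\<close>)

lemma rgraphD:
  assumes "rgraph r H"
  shows "finite (verts H)" "finite (edges H)" "e \<in> edges H \<Longrightarrow> e \<in> ksubsets (verts H) r"
proof -
  have "edges H \<subseteq> Pow (verts H)" using assms by (auto simp: rgraph_def)
  then show "finite (edges H)" using assms finite_subset by (auto simp: rgraph_def)
qed (use assms in \<open>auto simp: rgraph_def ksubsets_def\<close>)

lemma tp_norm_alt: "tp_norm t p H = (\<Sum>T\<in>ksubsets (verts H) t. real (deg H T) powr p)"
  by (simp add: tp_norm_def ksubsets_def)

lemma verts_del_vertex [simp]: "verts (del_vertex H v) = verts H - {v}"
  and edges_del_vertex [simp]: "edges (del_vertex H v) = {e \<in> edges H. v \<notin> e}"
  by (simp_all add: del_vertex_def)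

lemma deg_del_vertex: "v \<in> T \<Longrightarrow> deg (del_vertex H v) T = 0"
  unfolding deg_def by (auto simp: card_eq_0_iff)

lemma deg_split:
  assumes "finite (edges H)"
  shows "deg H T = deg (del_vertex H v) T + card {e \<in> edges H. v \<in> e \<and> T \<subseteq> e}"
proof -
  have "{e \<in> edges H. T \<subseteq> e} = {e \<in> edges (del_vertex H v). T \<subseteq> e} \<union> {e \<in> edges H. v \<in> e \<and> T \<subseteq> e}"
    by auto
  then show ?thesis unfolding deg_def using assms by (simp only:) (subst card_Un_disjoint, auto)
qed

lemma sum_incidence:
  fixes f :: "'a set \<Rightarrow> real"
  assumes "finite V" "finite E" "\<And>e. e \<in> E \<Longrightarrow> e \<subseteq> V"
  shows "(\<Sum>e\<in>E. \<Sum>T\<in>ksubsets e t. f T) = (\<Sum>T\<in>ksubsets V t. real (card {e \<in> E. T \<subseteq> e}) * f T)"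
proof -
  have "(\<Sum>e\<in>E. \<Sum>T\<in>ksubsets e t. f T) = (\<Sum>e\<in>E. \<Sum>T\<in>{T\<in>ksubsets V t. T \<subseteq> e}. f T)"
    using assms(3) by (intro sum.cong refl) (auto simp: ksubsets_def)
  also have "\<dots> = (\<Sum>T\<in>ksubsets V t. \<Sum>e\<in>{e \<in> E. T \<subseteq> e}. f T)"
    using assms by (intro sum.swap_restrict) auto
  finally show ?thesis by simp
qed

text \<open>Deleting \<open>v\<close> destroys the whole contribution
  \<open>d powr p = d * powr_slope p d\<close> of a set \<open>T\<close> through \<open>v\<close>,
  hence coefficient 1; for the other sets the degree only drops, and the derivative brings in the
  factor \<open>p\<close>.\<close>

definition vcoeff :: "real \<Rightarrow> nat \<Rightarrow> nat set \<Rightarrow> real" where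
  "vcoeff p v T = (if v \<in> T then 1 else p)"

text \<open>Linearization of the degree: moving each power to its tangent turns the degree of a vertex
  into a sum over the edges at that vertex, which is what random sampling can control.\<close>

definition lin_degree :: "nat \<Rightarrow> real \<Rightarrow> hgraph \<Rightarrow> nat \<Rightarrow> real" where
  "lin_degree t p H v = (\<Sum>e | e \<in> edges H \<and> v \<in> e. \<Sum>T\<in>ksubsets e t. vcoeff p v T * powr_slope p (real (deg H T)))"

lemma tp_degree_alt:
  assumes "rgraph r H" "v \<in> verts H"
  shows "tp_degree t p H v = (\<Sum>T\<in>ksubsets (verts H) t. real (deg H T) powr p - real (deg (del_vertex H v) T) powr p)"
proof -
  \<comment> \<open>Sets through \<open>v\<close> may be added to the sum: their degree after the
    deletion is 0, and \<open>0 powr p = 0\<close>.\<close>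
  have "(\<Sum>T\<in>ksubsets (verts H - {v}) t. real (deg (del_vertex H v) T) powr p)
    = (\<Sum>T\<in>ksubsets (verts H) t. real (deg (del_vertex H v) T) powr p)"
    using rgraphD(1)[OF assms(1)] deg_del_vertex[of v _ H]
    by (intro sum.mono_neutral_left) (auto simp: ksubsets_def)
  then show ?thesis by (simp add: tp_degree_def tp_norm_alt sum_subtractf)
qed

text \<open>For \<open>v\<close> outside \<open>T\<close>, take the tangent at the full degree and
  evaluate it at the smaller degree left after the deletion; for \<open>v\<close> in
  \<open>T\<close> the contributions agree.\<close>

lemma tp_degree_le_lin_degree:
  assumes "rgraph r H" "v \<in> verts H" "p \<ge> 1"
  shows "tp_degree t p H v \<le> lin_degree t p H v"
proof -
  note fin = rgraphD[OF assms(1)]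
  have "tp_degree t p H v \<le> (\<Sum>T\<in>ksubsets (verts H) t.
      real (card {e \<in> {e \<in> edges H. v \<in> e}. T \<subseteq> e}) * (vcoeff p v T * powr_slope p (real (deg H T))))"
    unfolding tp_degree_alt[OF assms(1,2)]
  proof (rule sum_mono)
    fix T
    have d: "real (deg H T) = real (deg (del_vertex H v) T) + real (card {e \<in> {e \<in> edges H. v \<in> e}. T \<subseteq> e})"
      using deg_split[OF fin(2), of T v] by simp
    show "real (deg H T) powr p - real (deg (del_vertex H v) T) powr p
      \<le> real (card {e \<in> {e \<in> edges H. v \<in> e}. T \<subseteq> e}) * (vcoeff p v T * powr_slope p (real (deg H T)))"
    proof (cases "v \<in> T")
      case True
      then show ?thesis using d assms powr_eq_mult_slope[of "real (deg H T)" p]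
        by (simp add: vcoeff_def deg_del_vertex)
    next
      case False
      then show ?thesis
        using d assms powr_ge_tangent[of "real (deg (del_vertex H v) T)" "real (deg H T)" p]
        by (simp add: vcoeff_def algebra_simps)
    qed
  qed
  also have "\<dots> = lin_degree t p H v"
    unfolding lin_degree_def using fin
    by (subst sum_incidence[symmetric, where V = "verts H"]) (auto simp: ksubsets_def)
  finally show ?thesis .
qed

text \<open>The reverse estimate takes the tangent at the degree left after the deletion. By
  monotonicity of the slope any smaller \<open>x T\<close> will do, which allows degrees known only
  approximately.\<close>

lemma tp_degree_ge:
  assumes "rgraph r H" "v \<in> verts H" "p \<ge> 1"
    and "\<And>T. T \<in> ksubsets (verts H) t \<Longrightarrow> 0 \<le> x T \<and>
       x T \<le> real (if v \<in> T then deg H T else deg (del_vertex H v) T)"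
  shows "(\<Sum>e | e \<in> edges H \<and> v \<in> e. \<Sum>T\<in>ksubsets e t. vcoeff p v T * powr_slope p (x T)) \<le> tp_degree t p H v"
proof -
  note fin = rgraphD[OF assms(1)]
  have "(\<Sum>e\<in>{e \<in> edges H. v \<in> e}. \<Sum>T\<in>ksubsets e t. vcoeff p v T * powr_slope p (x T))
    = (\<Sum>T\<in>ksubsets (verts H) t.
      real (card {e \<in> {e \<in> edges H. v \<in> e}. T \<subseteq> e}) * (vcoeff p v T * powr_slope p (x T)))"
    using fin by (intro sum_incidence) (auto simp: ksubsets_def)
  also have "\<dots> \<le> tp_degree t p H v"
    unfolding tp_degree_alt[OF assms(1,2)]
  proof (rule sum_mono)
    fix T assume T: "T \<in> ksubsets (verts H) t"
    define c where "c = real (card {e \<in> {e \<in> edges H. v \<in> e}. T \<subseteq> e})"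
    have d: "real (deg H T) = real (deg (del_vertex H v) T) + c"
      using deg_split[OF fin(2), of T v] by (simp add: c_def)
    have c: "c \<ge> 0" by (simp add: c_def)
    have "c * (vcoeff p v T * powr_slope p (x T))
       \<le> c * (vcoeff p v T * powr_slope p (real (if v \<in> T then deg H T else deg (del_vertex H v) T)))"
      using assms(3) assms(4)[OF T] c by (intro mult_left_mono powr_slope_mono) (auto simp: vcoeff_def)
    also have "\<dots> \<le> real (deg H T) powr p - real (deg (del_vertex H v) T) powr p"
    proof (cases "v \<in> T")
      case True
      then show ?thesis using d assms powr_eq_mult_slope[of "real (deg H T)" p]
        by (simp add: vcoeff_def deg_del_vertex)
    next
      case False
      then show ?thesis
        using d assms powr_ge_tangent[of "real (deg H T)" "real (deg (del_vertex H v) T)" p]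
        by (simp add: vcoeff_def algebra_simps)
    qed
    finally show "real (card {e \<in> {e \<in> edges H. v \<in> e}. T \<subseteq> e}) * (vcoeff p v T * powr_slope p (x T))
      \<le> real (deg H T) powr p - real (deg (del_vertex H v) T) powr p" by (simp only: c_def)
  qed
  finally show ?thesis by simp
qed

lemma tp_norm_eq_sum_edges:
  assumes "rgraph r H"
  shows "tp_norm t p H = (\<Sum>e\<in>edges H. \<Sum>T\<in>ksubsets e t. powr_slope p (real (deg H T)))"
  using rgraphD[OF assms]
  by (subst sum_incidence[where V = "verts H"])
     (auto simp: ksubsets_def tp_norm_def deg_def powr_eq_mult_slope)

text \<open>For a fixed edge \<open>e\<close> and a \<open>t\<close>-set \<open>T\<close> inside it,
  the coefficients of the \<open>t\<close> vertices in \<open>T\<close> and the \<open>r - t\<close>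
  others add up to \<open>t + p * (r - t)\<close>. This is where the constant in
  \<open>exdeg_tp\<close> comes from.\<close>

lemma sum_lin_degree:
  assumes "rgraph r H" "t \<le> r"
  shows "(\<Sum>v\<in>verts H. lin_degree t p H v) = (real t + p * (real r - real t)) * tp_norm t p H"
proof -
  note fin = rgraphD[OF assms(1)]
  have "(\<Sum>v\<in>verts H. lin_degree t p H v)
    = (\<Sum>e\<in>edges H. \<Sum>v | v \<in> verts H \<and> v \<in> e. \<Sum>T\<in>ksubsets e t. vcoeff p v T * powr_slope p (real (deg H T)))"
    unfolding lin_degree_def using fin by (intro sum.swap_restrict) auto
  also have "\<dots> = (\<Sum>e\<in>edges H. \<Sum>T\<in>ksubsets e t. (real t + p * (real r - real t)) * powr_slope p (real (deg H T)))"
  proof (rule sum.cong[OF refl])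
    fix e assume e: "e \<in> edges H"
    have e': "{v. v \<in> verts H \<and> v \<in> e} = e" "finite e" "card e = r"
      using fin(1) fin(3)[OF e] by (auto simp: ksubsets_def dest: finite_subset)
    have "(\<Sum>v\<in>e. vcoeff p v T) = real t + p * (real r - real t)" if "T \<in> ksubsets e t" for T
    proof -
      have T: "T \<subseteq> e" "card T = t" "finite T" using that ksubsetsD[OF e'(2)] by auto
      have "(\<Sum>v\<in>e. vcoeff p v T) = (\<Sum>v\<in>T. vcoeff p v T) + (\<Sum>v\<in>e - T. vcoeff p v T)"
        using sum.subset_diff[OF T(1) e'(2)] by (simp add: add.commute)
      also have "\<dots> = (\<Sum>v\<in>T. 1) + (\<Sum>v\<in>e - T. p)"
        by (intro arg_cong2[of _ _ _ _ "(+)"] sum.cong) (auto simp: vcoeff_def)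
      also have "\<dots> = real t + p * (real r - real t)"
        using T e' assms(2) by (simp add: card_Diff_subset of_nat_diff)
      finally show ?thesis .
    qed
    then show "(\<Sum>v | v \<in> verts H \<and> v \<in> e. \<Sum>T\<in>ksubsets e t. vcoeff p v T * powr_slope p (real (deg H T)))
      = (\<Sum>T\<in>ksubsets e t. (real t + p * (real r - real t)) * powr_slope p (real (deg H T)))"
      unfolding e'(1) by (subst sum.swap) (simp add: sum_distrib_right[symmetric])
  qed
  also have "\<dots> = (real t + p * (real r - real t)) * tp_norm t p H"
    unfolding tp_norm_eq_sum_edges[OF assms(1)] by (simp add: sum_distrib_left)
  finally show ?thesis .
qed

section \<open>Averaging over vertices and Jensen's inequality\<close>

lemma min_tp_degree_le:
  assumes "finite (verts H)" "v \<in> verts H"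
  shows "min_tp_degree t p H \<le> tp_degree t p H v"
  unfolding min_tp_degree_def using assms by (intro Min_le) auto

text \<open>The minimum is at most the average of the linearized degrees. This turns the degree
  hypothesis into the norm hypothesis of edge-stability.\<close>

lemma card_mult_min_tp_degree_le:
  assumes "rgraph r H" "t \<le> r" "p \<ge> 1"
  shows "real (card (verts H)) * min_tp_degree t p H \<le> (real t + p * (real r - real t)) * tp_norm t p H"
proof -
  have "real (card (verts H)) * min_tp_degree t p H = (\<Sum>v\<in>verts H. min_tp_degree t p H)" by simp
  also have "\<dots> \<le> (\<Sum>v\<in>verts H. lin_degree t p H v)"
    using min_tp_degree_le[OF rgraphD(1)[OF assms(1)]] tp_degree_le_lin_degree[OF assms(1) _ assms(3)]
    by (intro sum_mono) (meson order_trans)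
  finally show ?thesis unfolding sum_lin_degree[OF assms(1,2)] .
qed

text \<open>Fix \<open>T\<close>. Each edge containing \<open>T\<close> survives the deletion of
  \<open>n - r\<close> of the \<open>n - t\<close> vertices outside \<open>T\<close>, so the degree
  of \<open>T\<close> becomes \<open>q\<close> times itself on average; Jensen's inequality does the
  rest.\<close>

lemma sum_tp_norm_del_vertex_ge:
  assumes "rgraph r H" "card (verts H) = n" "t < n" "r \<le> n" "p \<ge> 1"
  shows "(real n - real t) * ((real n - real r) / (real n - real t)) powr p * tp_norm t p H
    \<le> (\<Sum>v\<in>verts H. tp_norm t p (del_vertex H v))"
proof -
  note fin = rgraphD[OF assms(1)]
  define q where "q = (real n - real r) / (real n - real t)"
  have q: "q \<ge> 0" "(real n - real t) * q = real n - real r" using assms by (auto simp: q_def)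
  have "(\<Sum>v\<in>verts H. tp_norm t p (del_vertex H v))
    = (\<Sum>v\<in>verts H. \<Sum>T | T \<in> ksubsets (verts H) t \<and> v \<notin> T. real (deg (del_vertex H v) T) powr p)"
    by (intro sum.cong refl) (auto simp: tp_norm_alt ksubsets_def intro!: sum.cong)
  also have "\<dots> = (\<Sum>T\<in>ksubsets (verts H) t. \<Sum>v | v \<in> verts H \<and> v \<notin> T. real (deg (del_vertex H v) T) powr p)"
    using fin by (intro sum.swap_restrict) auto
  also have "\<dots> \<ge> (\<Sum>T\<in>ksubsets (verts H) t. (real n - real t) * (q * real (deg H T)) powr p)"
  proof (rule sum_mono)
    fix T assume "T \<in> ksubsets (verts H) t"
    then have T: "T \<subseteq> verts H" "card T = t" "finite T" using ksubsetsD[OF fin(1)] by auto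
    define U where "U = {v. v \<in> verts H \<and> v \<notin> T}"
    define c where "c = q * real (deg H T)"
    have U: "finite U" "real (card U) = real n - real t"
    proof -
      have "U = verts H - T" by (auto simp: U_def)
      then show "finite U" "real (card U) = real n - real t"
        using T fin(1) assms(2,3) by (auto simp: card_Diff_subset of_nat_diff)
    qed
    have "(\<Sum>v\<in>U. real (deg (del_vertex H v) T)) = (\<Sum>v\<in>U. \<Sum>e | e \<in> {e\<in>edges H. T \<subseteq> e} \<and> v \<notin> e. 1)"
      by (intro sum.cong refl) (simp add: deg_def, intro arg_cong[where f=card], auto)
    also have "\<dots> = (\<Sum>e | e \<in> edges H \<and> T \<subseteq> e. \<Sum>v | v \<in> U \<and> v \<notin> e. 1)"
      using U fin by (subst sum.swap_restrict) auto
    also have "\<dots> = (\<Sum>e | e \<in> edges H \<and> T \<subseteq> e. real n - real r)"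
    proof (intro sum.cong refl)
      fix e assume "e \<in> {e. e \<in> edges H \<and> T \<subseteq> e}"
      then have "e \<in> ksubsets (verts H) r" "T \<subseteq> e" using fin(3) by auto
      then have e: "e \<subseteq> verts H" "card e = r" "finite e" "T \<subseteq> e"
        using ksubsetsD[OF fin(1)] by auto
      have "{v. v \<in> U \<and> v \<notin> e} = verts H - e" using e by (auto simp: U_def)
      then show "(\<Sum>v | v \<in> U \<and> v \<notin> e. 1) = real n - real r"
        using e assms by (simp add: card_Diff_subset of_nat_diff)
    qed
    also have "\<dots> = real (deg H T) * (real n - real r)" by (simp add: deg_def)
    also have "\<dots> = real (card U) * c" by (simp add: c_def U q(2)[symmetric] mult_ac)
    finally have S: "(\<Sum>v\<in>U. real (deg (del_vertex H v) T)) = real (card U) * c" .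
    \<comment> \<open>Jensen through the tangent at the mean \<open>c\<close>: the linear terms
      cancel in the sum.\<close>
    have "(real n - real t) * c powr p = (\<Sum>v\<in>U. c powr p + p * powr_slope p c * (real (deg (del_vertex H v) T) - c))"
      using U S by (simp add: sum.distrib sum_distrib_left[symmetric] sum_subtractf)
    also have "\<dots> \<le> (\<Sum>v\<in>U. real (deg (del_vertex H v) T) powr p)"
      using q assms(5) by (intro sum_mono powr_ge_tangent) (auto simp: c_def)
    finally show "(real n - real t) * (q * real (deg H T)) powr p
      \<le> (\<Sum>v | v \<in> verts H \<and> v \<notin> T. real (deg (del_vertex H v) T) powr p)"
      by (simp only: c_def U_def)
  qed
  finally show ?thesis
    using q by (simp add: tp_norm_alt powr_mult sum_distrib_left q_def[symmetric] mult_ac)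
qed

text \<open>Jensen's inequality for the \<open>t\<close>-degrees, whose sum counts every edge
  \<open>r choose t\<close> times.\<close>

lemma tp_norm_ge_edges:
  assumes "rgraph r H" "t \<le> card (verts H)" "p \<ge> 1"
  shows "real (card (verts H) choose t) * (real (r choose t) * real (card (edges H)) / real (card (verts H) choose t)) powr p
    \<le> tp_norm t p H"
proof -
  note fin = rgraphD[OF assms(1)]
  define N where "N = real (card (verts H) choose t)"
  define c where "c = real (r choose t) * real (card (edges H)) / N"
  have N: "N > 0" "real (card (ksubsets (verts H) t)) = N"
    using assms(2) fin by (auto simp: N_def card_ksubsets zero_less_binomial)
  have "(\<Sum>T\<in>ksubsets (verts H) t. real (deg H T)) = (\<Sum>e\<in>edges H. \<Sum>T\<in>ksubsets e t. 1)"
    using fin by (subst sum_incidence[where V = "verts H"]) (auto simp: deg_def ksubsets_def)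
  also have "\<dots> = (\<Sum>e\<in>edges H. real (r choose t))"
  proof (intro sum.cong refl)
    fix e assume "e \<in> edges H"
    then have "finite e" "card e = r" using fin(3) ksubsetsD[OF fin(1)] by auto
    then show "(\<Sum>T\<in>ksubsets e t. 1) = real (r choose t)" by (simp add: card_ksubsets)
  qed
  finally have S: "(\<Sum>T\<in>ksubsets (verts H) t. real (deg H T)) = N * c" using N by (simp add: c_def)
  have "N * c powr p = (\<Sum>T\<in>ksubsets (verts H) t. c powr p + p * powr_slope p c * (real (deg H T) - c))"
    using N S by (simp add: sum.distrib sum_distrib_left[symmetric] sum_subtractf)
  also have "\<dots> \<le> tp_norm t p H"
    unfolding tp_norm_alt using assms(3) N by (intro sum_mono powr_ge_tangent) (auto simp: c_def)
  finally show ?thesis by (simp only: c_def N_def)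
qed

lemma tp_norm_1:
  assumes "rgraph r H"
  shows "tp_norm t 1 H = real (r choose t) * real (card (edges H))"
proof -
  note fin = rgraphD[OF assms]
  have "card (ksubsets e t) = r choose t" if "e \<in> edges H" for e
    using fin(3)[OF that] ksubsetsD[OF fin(1)] by (metis card_ksubsets)
  then show ?thesis unfolding tp_norm_eq_sum_edges[OF assms] by (simp add: powr_slope_def)
qed


subsection \<open>Densities\<close>

definition induced :: "hgraph \<Rightarrow> nat set \<Rightarrow> hgraph" where
  "induced H S = HGraph S {e \<in> edges H. e \<subseteq> S}"

lemma verts_induced [simp]: "verts (induced H S) = S"
  and edges_induced [simp]: "edges (induced H S) = {e \<in> edges H. e \<subseteq> S}"
  by (simp_all add: induced_def)

lemma del_vertex_induced: "del_vertex (induced H S) v = induced H (S - {v})"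
  by (auto simp: del_vertex_def induced_def)

lemma induced_verts: "rgraph r H \<Longrightarrow> induced H (verts H) = H"
  by (cases H) (auto simp: induced_def rgraph_def)

lemma induced_free_rgraphs:
  assumes "H \<in> free_rgraphs r \<F> n" "S \<in> ksubsets (verts H) k"
  shows "induced H S \<in> free_rgraphs r \<F> k"
proof -
  have H: "rgraph r H" "free_of \<F> H" using assms(1) by (auto simp: free_rgraphs_def)
  have S: "S \<subseteq> verts H" "card S = k" "finite S"
    using ksubsetsD[OF rgraphD(1)[OF H(1)] assms(2)] by auto
  have "contains_copy H G" if "contains_copy (induced H S) G" for G
    using that S(1) unfolding contains_copy_def by fastforce
  then show ?thesis using H S by (auto simp: free_rgraphs_def free_of_def rgraph_def)
qed

lemma free_rgraphs_empty_mono: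
  assumes "free_rgraphs r \<F> k = {}" "k \<le> n"
  shows "free_rgraphs r \<F> n = {}"
proof (rule ccontr)
  assume "free_rgraphs r \<F> n \<noteq> {}"
  then obtain H where H: "H \<in> free_rgraphs r \<F> n" by blast
  then have "k \<le> card (verts H)" using assms(2) by (simp add: free_rgraphs_def)
  then obtain S where "S \<subseteq> verts H" "card S = k" by (rule obtain_subset_with_card_n)
  then show False using induced_free_rgraphs[OF H, of S k] assms(1) by (auto simp: ksubsets_def)
qed

lemma card_edges_le:
  assumes "rgraph r H"
  shows "card (edges H) \<le> card (verts H) choose r"
proof -
  have "edges H \<subseteq> ksubsets (verts H) r" using rgraphD(3)[OF assms] by blast
  then show ?thesis
    using card_mono[of "ksubsets (verts H) r" "edges H"] rgraphD(1)[OF assms] by (simp add: card_ksubsets)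
qed

text \<open>The labelled graphs of a given order form an infinite set, so \<open>Max\<close> in
  \<open>ex_tp\<close> is meaningful only because the norms take finitely many values: they are sums
  of a fixed number of terms from a finite range.\<close>

lemma finite_bounded_sums:
  fixes g :: "nat \<Rightarrow> real"
  shows "finite {y. \<exists>A f. finite (A :: 'a set) \<and> card A = N \<and> (\<forall>x\<in>A. f x \<le> C) \<and> y = (\<Sum>x\<in>A. g (f x))}"
    (is "finite (?S N)")
proof (induction N)
  case 0
  have "?S 0 \<subseteq> {0}" by auto
  then show ?case using finite_subset by blast
next
  case (Suc N)
  have "?S (Suc N) \<subseteq> (\<lambda>(y, c). y + g c) ` (?S N \<times> {..C})"
  proof
    fix y assume "y \<in> ?S (Suc N)"
    then have "\<exists>A f. finite (A :: 'a set) \<and> card A = Suc N \<and> (\<forall>x\<in>A. f x \<le> C) \<and> y = (\<Sum>x\<in>A. g (f x))"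
      by (rule CollectD)
    then obtain A :: "'a set" and f where A: "finite A" "card A = Suc N" "\<forall>x\<in>A. f x \<le> C" "y = (\<Sum>x\<in>A. g (f x))"
      by (elim exE conjE) (rule that)
    have "A \<noteq> {}" using A(2) by auto
    then obtain a where a: "a \<in> A" by blast
    define z where "z = (\<Sum>x\<in>A - {a}. g (f x))"
    have "y = (\<lambda>(y, c). y + g c) (z, f a)"
      using sum.remove[OF A(1) a, of "\<lambda>x. g (f x)"] A(4) by (simp add: z_def)
    moreover have "finite (A - {a})" "card (A - {a}) = N" "\<forall>x\<in>A - {a}. f x \<le> C"
      using A a by auto
    then have "z \<in> ?S N" unfolding z_def by (intro CollectI exI[of _ "A - {a}"] exI[of _ f] conjI refl)
    then have "(z, f a) \<in> ?S N \<times> {..C}" using A(3) a by (intro SigmaI) auto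
    ultimately show "y \<in> (\<lambda>(y, c). y + g c) ` (?S N \<times> {..C})" by (rule image_eqI)
  qed
  then show ?case
    by (rule finite_subset) (intro finite_imageI finite_cartesian_product Suc.IH finite_atMost)
qed

lemma finite_tp_norms: "finite (tp_norm t p ` free_rgraphs r \<F> n)"
proof (rule finite_subset[OF _ finite_bounded_sums])
  show "tp_norm t p ` free_rgraphs r \<F> n \<subseteq> {y. \<exists>A f. finite (A :: nat set set) \<and> card A = n choose t
     \<and> (\<forall>x\<in>A. f x \<le> n choose r) \<and> y = (\<Sum>x\<in>A. real (f x) powr p)}"
  proof
    fix y assume "y \<in> tp_norm t p ` free_rgraphs r \<F> n"
    then obtain H where H: "rgraph r H" "card (verts H) = n" "y = tp_norm t p H"
      by (auto simp: free_rgraphs_def)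
    note fin = rgraphD[OF H(1)]
    have "deg H T \<le> n choose r" for T
      using card_mono[OF fin(2), of "{e \<in> edges H. T \<subseteq> e}"] card_edges_le[OF H(1)] H(2)
      by (auto simp: deg_def)
    then show "y \<in> {y. \<exists>A f. finite (A :: nat set set) \<and> card A = n choose t
     \<and> (\<forall>x\<in>A. f x \<le> n choose r) \<and> y = (\<Sum>x\<in>A. real (f x) powr p)}"
      using fin(1) H(2,3) by (intro CollectI exI[of _ "ksubsets (verts H) t"] exI[of _ "deg H"])
        (auto simp: card_ksubsets tp_norm_alt)
  qed
qed

lemma tp_norm_le_ex_tp: "H \<in> free_rgraphs r \<F> n \<Longrightarrow> tp_norm t p H \<le> ex_tp r t p \<F> n"
  unfolding ex_tp_def by (intro Max_ge finite_tp_norms) auto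

lemma ex_tp_attained:
  assumes "free_rgraphs r \<F> n \<noteq> {}"
  obtains H where "H \<in> free_rgraphs r \<F> n" "tp_norm t p H = ex_tp r t p \<F> n"
proof -
  have "ex_tp r t p \<F> n \<in> tp_norm t p ` free_rgraphs r \<F> n"
    unfolding ex_tp_def using assms by (intro Max_in finite_tp_norms) auto
  then show ?thesis using that by auto
qed

lemma tp_norm_nonneg: "tp_norm t p H \<ge> 0"
  unfolding tp_norm_def by (intro sum_nonneg) auto

lemma finite_card_edges: "finite ((\<lambda>H. card (edges H)) ` free_rgraphs r \<F> n)"
  by (rule finite_subset[of _ "{..n choose r}"]) (auto simp: free_rgraphs_def dest: card_edges_le)

lemma ex_attained:
  assumes "free_rgraphs r \<F> n \<noteq> {}"
  obtains H where "H \<in> free_rgraphs r \<F> n" "card (edges H) = ex r \<F> n"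
proof -
  have "ex r \<F> n \<in> (\<lambda>H. card (edges H)) ` free_rgraphs r \<F> n"
    unfolding ex_def using assms by (intro Max_in finite_card_edges) auto
  then show ?thesis using that by auto
qed

lemma card_edges_le_ex: "H \<in> free_rgraphs r \<F> n \<Longrightarrow> card (edges H) \<le> ex r \<F> n"
  unfolding ex_def by (intro Max_ge finite_card_edges) auto

text \<open>The denominator is the norm of the complete \<open>r\<close>-graph on \<open>n\<close>
  vertices, in which every \<open>t\<close>-set has degree
  \<open>(n - t) choose (r - t)\<close>.\<close>

definition tp_density :: "nat \<Rightarrow> nat \<Rightarrow> real \<Rightarrow> hgraph set \<Rightarrow> nat \<Rightarrow> real" where
  "tp_density r t p \<F> n = ex_tp r t p \<F> n / (real (n choose t) * real ((n - t) choose (r - t)) powr p)"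

text \<open>The averaging argument of Katona, Nemetz and Simonovits: the factor \<open>s\<close>
  lost on average when a vertex of an extremal graph is deleted is exactly the ratio of the two
  normalizations.\<close>

lemma tp_density_Suc_le:
  assumes "free_rgraphs r \<F> (Suc n) \<noteq> {}" "t < r" "r \<le> n" "p \<ge> 1"
  shows "tp_density r t p \<F> (Suc n) \<le> tp_density r t p \<F> n"
proof -
  define m where "m = Suc n"
  define q where "q = (real m - real r) / (real m - real t)"
  define s where "s = (real m - real t) / real m * q powr p"
  obtain H where H: "H \<in> free_rgraphs r \<F> m" "tp_norm t p H = ex_tp r t p \<F> m"
    using ex_tp_attained assms(1) unfolding m_def by metis
  have H': "rgraph r H" "card (verts H) = m" using H(1) by (auto simp: free_rgraphs_def)
  have q: "q > 0" using assms by (simp add: q_def m_def)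
  have s: "s > 0" using assms q by (simp add: s_def m_def)
  have "(real m - real t) * q powr p * ex_tp r t p \<F> m \<le> (\<Sum>v\<in>verts H. tp_norm t p (del_vertex H v))"
    using sum_tp_norm_del_vertex_ge[OF H', of t p] assms H(2) by (simp add: q_def m_def)
  also have "\<dots> \<le> (\<Sum>v\<in>verts H. ex_tp r t p \<F> n)"
  proof (intro sum_mono tp_norm_le_ex_tp)
    fix v assume "v \<in> verts H"
    then have "verts H - {v} \<in> ksubsets (verts H) n"
      using H' rgraphD(1)[OF H'(1)] by (auto simp: ksubsets_def m_def)
    then show "del_vertex H v \<in> free_rgraphs r \<F> n"
      using induced_free_rgraphs[OF H(1)] del_vertex_induced[of H "verts H" v] induced_verts[OF H'(1)]
      by metis
  qed
  also have "\<dots> = real m * ex_tp r t p \<F> n" by (simp add: H')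
  finally have ex: "s * ex_tp r t p \<F> m \<le> ex_tp r t p \<F> n" by (simp add: s_def m_def field_simps)
  have "(m - t) * (m choose t) = m * (n choose t)"
    using binomial_absorb_comp[of m t] by (simp add: m_def)
  then have "real (m - t) * real (m choose t) = real m * real (n choose t)" by (metis of_nat_mult)
  then have c1: "real (n choose t) = (real m - real t) / real m * real (m choose t)"
    using assms by (simp add: m_def of_nat_diff field_simps)
  have "(m - r) * ((m - t) choose (r - t)) = (m - t) * ((n - t) choose (r - t))"
    using binomial_absorb_comp[of "m - t" "r - t"] assms by (simp add: m_def)
  then have "real (m - r) * real ((m - t) choose (r - t)) = real (m - t) * real ((n - t) choose (r - t))"
    by (metis of_nat_mult)
  then have "real ((n - t) choose (r - t)) = q * real ((m - t) choose (r - t))"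
    using assms by (simp add: m_def q_def of_nat_diff field_simps)
  then have c2: "real ((n - t) choose (r - t)) powr p = q powr p * real ((m - t) choose (r - t)) powr p"
    using q by (simp add: powr_mult)
  have "tp_density r t p \<F> m = (s * ex_tp r t p \<F> m) / (s * (real (m choose t) * real ((m - t) choose (r - t)) powr p))"
    using s by (simp add: tp_density_def)
  also have "\<dots> \<le> ex_tp r t p \<F> n / (s * (real (m choose t) * real ((m - t) choose (r - t)) powr p))"
    using ex s by (intro divide_right_mono) auto
  also have "\<dots> = tp_density r t p \<F> n"
    unfolding tp_density_def c1 c2 by (simp add: s_def mult_ac)
  finally show ?thesis by (simp add: m_def)
qed

lemma tp_density_1:
  assumes "free_rgraphs r \<F> n \<noteq> {}" "t \<le> r"
  shows "tp_density r t 1 \<F> n = real (ex r \<F> n) / real (n choose r)"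
proof -
  have "ex_tp r t 1 \<F> n = real (r choose t) * real (ex r \<F> n)"
  proof (rule antisym)
    obtain H where H: "H \<in> free_rgraphs r \<F> n" "tp_norm t 1 H = ex_tp r t 1 \<F> n"
      using ex_tp_attained assms(1) by metis
    then have "tp_norm t 1 H = real (r choose t) * real (card (edges H))"
      by (intro tp_norm_1) (simp add: free_rgraphs_def)
    then show "ex_tp r t 1 \<F> n \<le> real (r choose t) * real (ex r \<F> n)"
      using card_edges_le_ex[OF H(1)] H(2) by (simp add: mult_left_mono)
    obtain H where H: "H \<in> free_rgraphs r \<F> n" "card (edges H) = ex r \<F> n"
      using ex_attained assms(1) by metis
    then have "tp_norm t 1 H = real (r choose t) * real (card (edges H))"
      by (intro tp_norm_1) (simp add: free_rgraphs_def)
    then show "real (r choose t) * real (ex r \<F> n) \<le> ex_tp r t 1 \<F> n"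
      using tp_norm_le_ex_tp[OF H(1), of t 1] H(2) by simp
  qed
  moreover have "real (n choose t) * real ((n - t) choose (r - t)) = real (n choose r) * real (r choose t)"
    using choose_times_choose[OF assms(2), of n] by (metis of_nat_mult)
  moreover have "real (r choose t) > 0" using assms(2) by (simp add: zero_less_binomial)
  ultimately show ?thesis by (simp add: tp_density_def)
qed

lemma tp_density_ge_ex:
  assumes "free_rgraphs r \<F> n \<noteq> {}" "t \<le> r" "r \<le> n" "p \<ge> 1"
  shows "(real (ex r \<F> n) / real (n choose r)) powr p \<le> tp_density r t p \<F> n"
proof -
  obtain H where H: "H \<in> free_rgraphs r \<F> n" "card (edges H) = ex r \<F> n"
    using ex_attained assms(1) by metis
  then have H': "rgraph r H" "card (verts H) = n" by (auto simp: free_rgraphs_def)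
  define N where "N = real ((n - t) choose (r - t))"
  have pos: "real (n choose t) > 0" "N > 0" "real (r choose t) > 0" "real (n choose r) > 0"
    using assms by (auto simp: N_def zero_less_binomial)
  have "real (n choose t) * N = real (n choose r) * real (r choose t)"
    unfolding N_def using choose_times_choose[OF assms(2), of n] by (metis of_nat_mult)
  then have "real (ex r \<F> n) / real (n choose r) = real (r choose t) * real (ex r \<F> n) / real (n choose t) / N"
    using pos by (simp add: field_simps)
  then have "(real (ex r \<F> n) / real (n choose r)) powr p
      = real (n choose t) * (real (r choose t) * real (ex r \<F> n) / real (n choose t)) powr p / (real (n choose t) * N powr p)"
    using pos by (simp add: powr_divide powr_mult)
  also have "\<dots> \<le> ex_tp r t p \<F> n / (real (n choose t) * N powr p)"
  proof (rule divide_right_mono)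
    show "real (n choose t) * (real (r choose t) * real (ex r \<F> n) / real (n choose t)) powr p \<le> ex_tp r t p \<F> n"
      using tp_norm_ge_edges[OF H'(1), of t p] tp_norm_le_ex_tp[OF H(1), of t p] assms H(2) H'(2) by simp
  qed simp
  finally show ?thesis by (simp add: tp_density_def N_def)
qed

lemma tp_density_mono:
  assumes "\<And>n. free_rgraphs r \<F> n \<noteq> {}" "t < r" "r \<le> k" "k \<le> n" "p \<ge> 1"
  shows "tp_density r t p \<F> n \<le> tp_density r t p \<F> k"
  using assms(4)
proof (induction n rule: dec_induct)
  case (step n)
  then show ?case using tp_density_Suc_le[OF assms(1,2), of n p] assms(3,5) by linarith
qed simp

lemma tp_density_tendsto:
  assumes "\<And>n. free_rgraphs r \<F> n \<noteq> {}" "t < r" "p \<ge> 1"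
  obtains L where "tp_density r t p \<F> \<longlonglongrightarrow> L" "\<And>n. n \<ge> r \<Longrightarrow> L \<le> tp_density r t p \<F> n"
proof -
  \<comment> \<open>Monotonicity is available only from order \<open>r\<close> on, hence the
    shift.\<close>
  define f where "f = (\<lambda>n. tp_density r t p \<F> (n + r))"
  have nonneg: "0 \<le> f n" for n
  proof -
    obtain H where "tp_norm t p H = ex_tp r t p \<F> (n + r)"
      using ex_tp_attained assms(1) by metis
    then have "ex_tp r t p \<F> (n + r) \<ge> 0" using tp_norm_nonneg[of t p H] by simp
    then show ?thesis by (simp add: f_def tp_density_def)
  qed
  have dec: "\<forall>i. f (Suc i) \<le> f i"
    using tp_density_mono[OF assms(1,2)] assms(3) by (simp add: f_def)
  obtain L where L: "f \<longlonglongrightarrow> L" "\<forall>i. L \<le> f i"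
    using decseq_convergent[of f 0] dec nonneg by (auto simp: decseq_Suc_iff)
  have "tp_density r t p \<F> \<longlonglongrightarrow> L" using L(1) unfolding f_def by (rule LIMSEQ_offset)
  moreover have "L \<le> tp_density r t p \<F> n" if "n \<ge> r" for n
    using L(2)[rule_format, of "n - r"] that by (simp add: f_def)
  ultimately show ?thesis using that by blast
qed

text \<open>The Turan ratio is \<open>tp_density\<close> for \<open>t = 0\<close> and
  \<open>p = 1\<close>. Its monotone convergence makes the \<open>lim\<close> in
  \<open>turan_density\<close> a genuine limit, which lies below every term from order
  \<open>r\<close> on.\<close>

lemma turan_density_le:
  assumes "\<And>n. free_rgraphs r \<F> n \<noteq> {}" "r > 0" "n \<ge> r"
  shows "turan_density r \<F> \<le> real (ex r \<F> n) / real (n choose r)"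
proof -
  have eq: "tp_density r 0 1 \<F> = (\<lambda>n. real (ex r \<F> n) / real (n choose r))"
    using tp_density_1[OF assms(1)] by auto
  obtain L where "tp_density r 0 1 \<F> \<longlonglongrightarrow> L" "\<And>n. n \<ge> r \<Longrightarrow> L \<le> tp_density r 0 1 \<F> n"
    using tp_density_tendsto[OF assms(1), of 0 1] assms(2) by auto
  then show ?thesis unfolding turan_density_def eq using limI assms(3) by metis
qed

lemma tp_density_limit_pos:
  assumes "\<And>n. free_rgraphs r \<F> n \<noteq> {}" "t < r" "p \<ge> 1" "nondegenerate r \<F>"
  obtains L where "L > 0" "tp_density r t p \<F> \<longlonglongrightarrow> L" "\<And>n. n \<ge> r \<Longrightarrow> L \<le> tp_density r t p \<F> n"
proof -
  obtain L where L: "tp_density r t p \<F> \<longlonglongrightarrow> L" "\<And>n. n \<ge> r \<Longrightarrow> L \<le> tp_density r t p \<F> n"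
    using tp_density_tendsto[OF assms(1-3)] by blast
  have pos: "turan_density r \<F> > 0" using assms(4) by (simp add: nondegenerate_def)
  have "turan_density r \<F> powr p \<le> tp_density r t p \<F> n" if "n \<ge> r" for n
  proof -
    have "turan_density r \<F> powr p \<le> (real (ex r \<F> n) / real (n choose r)) powr p"
      using turan_density_le[OF assms(1) _ that] pos assms(2,3) by (intro powr_mono2) auto
    also have "\<dots> \<le> tp_density r t p \<F> n" using tp_density_ge_ex[OF assms(1)] assms(2,3) that by simp
    finally show ?thesis .
  qed
  then have "turan_density r \<F> powr p \<le> L" using LIMSEQ_le_const[OF L(1)] by blast
  moreover have "turan_density r \<F> powr p > 0" using pos by simp
  ultimately have "L > 0" by linarith
  then show ?thesis using that L by blast
qed

text \<open>Isolates the scale of a vertex degree, the last factor, from the density. Degrees at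
  orders \<open>n\<close> and \<open>k\<close> become comparable after division by their
  scales.\<close>

lemma exdeg_tp_eq:
  assumes "r > 0" "t \<le> r" "r \<le> n"
  shows "exdeg_tp r t p \<F> n = (real t + p * (real r - real t)) * real (r choose t) / real r * tp_density r t p \<F> n
     * (powr_slope p (real ((n - t) choose (r - t))) * real ((n - 1) choose (r - 1)))"
proof -
  define N where "N = real ((n - t) choose (r - t))"
  define D where "D = tp_density r t p \<F> n"
  have pos: "real (n choose t) > 0" "N > 0" "real n > 0" "real r > 0"
    using assms by (auto simp: N_def zero_less_binomial)
  have cc: "real (n choose t) * N = real (n choose r) * real (r choose t)"
    unfolding N_def using choose_times_choose[OF assms(2), of n] by (metis of_nat_mult)
  have ab: "real r * real (n choose r) = real n * real ((n - 1) choose (r - 1))"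
    using times_binomial_minus1_eq[OF assms(1), of n] by (metis of_nat_mult)
  have "ex_tp r t p \<F> n = D * (real (n choose t) * N powr p)"
    using pos by (simp add: D_def tp_density_def N_def)
  also have "\<dots> = D * powr_slope p N * (real (n choose t) * N)"
    using pos powr_eq_mult_slope[of N p] by simp
  also have "\<dots> = D * powr_slope p N * real (r choose t) * (real r * real (n choose r)) / real r"
    unfolding cc using pos by simp
  also have "\<dots> = D * powr_slope p N * real (r choose t) * real n * real ((n - 1) choose (r - 1)) / real r"
    unfolding ab by simp
  finally show ?thesis using pos by (simp add: exdeg_tp_def D_def N_def)
qed


subsection \<open>Typical sets\<close>

text \<open>Only the lower half of uniform continuity on \<open>[0, 1]\<close> is needed. With
  \<open>s = p - 1\<close>, the slope \<open>z powr s\<close> is constant for \<open>p = 1\<close>,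
  has derivative at most \<open>s\<close> for \<open>s \<ge> 1\<close>, and is subadditive for
  \<open>0 < s < 1\<close>.\<close>

lemma powr_slope_uniform:
  assumes "p \<ge> 1" "\<omega> > 0"
  obtains h where "h > 0" "\<And>u x. 0 \<le> x \<Longrightarrow> u - h \<le> x \<Longrightarrow> u \<le> 1 \<Longrightarrow> 0 \<le> u \<Longrightarrow> powr_slope p u - \<omega> \<le> powr_slope p x"
proof (cases "p = 1")
  case True
  then show ?thesis using assms that[of 1] by (simp add: powr_slope_def)
next
  case False
  define s where "s = p - 1"
  have s: "s > 0" using False assms by (simp add: s_def)
  have g: "powr_slope p z = z powr s" for z using False by (simp add: powr_slope_def s_def)
  show ?thesis
  proof (cases "s \<ge> 1")
    case True
    have "u powr s - \<omega> \<le> x powr s" if "0 \<le> x" "u - \<omega> / s \<le> x" "u \<le> 1" "0 \<le> u" for u x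
    proof (cases "x \<le> u")
      case le: True
      have "s * powr_slope s u * (u - x) \<le> s * 1 * (\<omega> / s)"
        using that s le True assms powr_slope_le_1[of s u] powr_slope_nonneg[of s u]
        by (intro mult_mono) auto
      then show ?thesis using powr_ge_tangent[of x u s] that True s by (simp add: algebra_simps)
    next
      case False
      then have "u powr s \<le> x powr s" using that s by (intro powr_mono2) auto
      then show ?thesis using assms by simp
    qed
    then show ?thesis using that[of "\<omega> / s"] s assms by (simp add: g)
  next
    case False
    define h where "h = \<omega> powr (1 / s)"
    have h: "h > 0" "h powr s = \<omega>" using assms s by (auto simp: h_def powr_powr)
    have "u powr s - \<omega> \<le> x powr s" if x: "0 \<le> x" "u - h \<le> x" "0 \<le> u" for u x
    proof (cases "u \<le> x")
      case True
      then have "u powr s \<le> x powr s" using s x by (intro powr_mono2) auto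
      then show ?thesis using assms by linarith
    next
      case False
      define y where "y = u - x"
      have y: "0 < y" "y \<le> h" "u > 0" "y \<le> u" "x \<le> u" using False x by (auto simp: y_def)
      \<comment> \<open>Subadditivity: raising two fractions with sum 1 to a power below 1 does not
        decrease them.\<close>
      have "x / u + y / u = 1" using y by (simp add: y_def field_simps)
      moreover have "(x / u) powr 1 \<le> (x / u) powr s" "(y / u) powr 1 \<le> (y / u) powr s"
        using \<open>\<not> s \<ge> 1\<close> y x by (intro powr_mono'; simp)+
      ultimately have "1 \<le> (x powr s + y powr s) / u powr s"
        using x y by (simp add: powr_divide add_divide_distrib)
      then have "u powr s \<le> x powr s + y powr s" using y by (simp add: le_divide_eq)
      also have "y powr s \<le> h powr s" using y s by (intro powr_mono2) auto
      finally show ?thesis using h by simp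
    qed
    then show ?thesis using that[of h] h by (simp add: g)
  qed
qed

lemma sum_edges_link:
  fixes f :: "nat set \<Rightarrow> real"
  assumes "rgraph r H" "S \<subseteq> verts H" "A \<in> ksubsets S a" "a \<le> r"
  shows "(\<Sum>e | e \<in> edges H \<and> A \<subseteq> e \<and> e \<subseteq> S. f e)
    = (\<Sum>B\<in>ksubsets (S - A) (r - a). if A \<union> B \<in> edges H then f (A \<union> B) else 0)"
proof -
  note fin = rgraphD[OF assms(1)]
  have fS: "finite S" using assms(2) fin(1) finite_subset by blast
  have A: "A \<subseteq> S" "card A = a" "finite A" using ksubsetsD[OF fS assms(3)] by auto
  have "(\<Sum>B\<in>ksubsets (S - A) (r - a). if A \<union> B \<in> edges H then f (A \<union> B) else 0)
    = (\<Sum>B | B \<in> ksubsets (S - A) (r - a) \<and> A \<union> B \<in> edges H. f (A \<union> B))"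
    using fS by (simp add: sum.inter_filter)
  also have "\<dots> = (\<Sum>e | e \<in> edges H \<and> A \<subseteq> e \<and> e \<subseteq> S. f e)"
  proof (rule sum.reindex_bij_witness[of _ "\<lambda>e. e - A" "\<lambda>B. A \<union> B"], goal_cases)
    case (4 e)
    then have "card e = r" "finite e" using fin ksubsetsD[OF fin(1)] by blast+
    then have "card (e - A) = r - a" using 4 A by (simp add: card_Diff_subset)
    then show ?case using 4 by (auto simp: ksubsets_def Un_absorb1)
  qed (use A in \<open>auto simp: ksubsets_def Un_absorb1\<close>)
  finally show ?thesis by simp
qed

lemma deg_induced:
  "real (deg (induced H S) A) = (\<Sum>e | e \<in> edges H \<and> A \<subseteq> e \<and> e \<subseteq> S. 1)"
  by (simp add: deg_def) (intro arg_cong[where f = card], auto)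

lemma deg_le:
  assumes "rgraph r H" "A \<in> ksubsets (verts H) a" "a \<le> r"
  shows "deg H A \<le> (card (verts H) - a) choose (r - a)"
proof -
  note fin = rgraphD[OF assms(1)]
  have "real (deg H A) = (\<Sum>e | e \<in> edges H \<and> A \<subseteq> e \<and> e \<subseteq> verts H. 1)"
    using deg_induced[of H "verts H" A] by (simp add: induced_verts[OF assms(1)])
  also have "\<dots> = (\<Sum>B\<in>ksubsets (verts H - A) (r - a). if A \<union> B \<in> edges H then 1 else 0)"
    using assms by (intro sum_edges_link) auto
  also have "\<dots> \<le> (\<Sum>B\<in>ksubsets (verts H - A) (r - a). 1)"
    by (intro sum_mono) auto
  also have "\<dots> = real ((card (verts H) - a) choose (r - a))"
    using card_Diff_ksubsets[OF fin(1) assms(2)] fin(1) by (simp add: card_ksubsets)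
  finally show ?thesis by simp
qed

definition rel_deg :: "nat \<Rightarrow> nat \<Rightarrow> hgraph \<Rightarrow> nat set \<Rightarrow> real" where
  "rel_deg r t H T = real (deg H T) / real ((card (verts H) - t) choose (r - t))"

text \<open>The share of \<open>e\<close> in \<open>lin_degree\<close> with all degrees scaled into
  \<open>[0, 1]\<close>; it is therefore bounded independently of the order of \<open>H\<close>, as
  the tail bounds require.\<close>

definition edge_weight :: "nat \<Rightarrow> nat \<Rightarrow> real \<Rightarrow> hgraph \<Rightarrow> nat \<Rightarrow> nat set \<Rightarrow> real" where
  "edge_weight r t p H v e = (\<Sum>T\<in>ksubsets e t. vcoeff p v T * powr_slope p (rel_deg r t H T))"

text \<open>The weights on both sides are those of the whole graph \<open>H\<close>, not of the induced one, so that
  each clause is a lower tail event for one fixed weight function.\<close>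

definition typical :: "nat \<Rightarrow> nat \<Rightarrow> real \<Rightarrow> real \<Rightarrow> hgraph \<Rightarrow> nat set \<Rightarrow> bool" where
  "typical r t p \<eta> H S \<longleftrightarrow>
     (\<forall>T\<in>ksubsets S t. (rel_deg r t H T - \<eta>) * real ((card S - t) choose (r - t)) \<le> real (deg (induced H S) T)) \<and>
     (\<forall>v\<in>S. ((\<Sum>e | e \<in> edges H \<and> v \<in> e. edge_weight r t p H v e) / real ((card (verts H) - 1) choose (r - 1))
          - p * real (r choose t) * \<eta>) * real ((card S - 1) choose (r - 1))
        \<le> (\<Sum>e | e \<in> edges H \<and> v \<in> e \<and> e \<subseteq> S. edge_weight r t p H v e))"

lemma rel_deg_bounds:
  assumes "rgraph r H" "T \<in> ksubsets (verts H) t" "t \<le> r"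
  shows "0 \<le> rel_deg r t H T \<and> rel_deg r t H T \<le> 1"
  using deg_le[OF assms] by (auto simp: rel_deg_def divide_le_eq)

lemma sum_vcoeff_le:
  assumes "finite e" "card e = r" "p \<ge> 1"
  shows "(\<Sum>T\<in>ksubsets e t. vcoeff p v T) \<le> p * real (r choose t)"
proof -
  have "(\<Sum>T\<in>ksubsets e t. vcoeff p v T) \<le> (\<Sum>T\<in>ksubsets e t. p)"
    using assms(3) by (intro sum_mono) (auto simp: vcoeff_def)
  then show ?thesis using assms by (simp add: card_ksubsets mult.commute)
qed

lemma edge_weight_bounds:
  assumes "rgraph r H" "e \<in> edges H" "t \<le> r" "p \<ge> 1"
  shows "0 \<le> edge_weight r t p H v e \<and> edge_weight r t p H v e \<le> p * real (r choose t)"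
proof -
  note fin = rgraphD[OF assms(1)]
  have e: "e \<subseteq> verts H" "card e = r" "finite e" using ksubsetsD[OF fin(1) fin(3)[OF assms(2)]] by auto
  have b: "0 \<le> rel_deg r t H T \<and> rel_deg r t H T \<le> 1" if "T \<in> ksubsets e t" for T
    using rel_deg_bounds[OF assms(1) _ assms(3)] that e(1) by (auto simp: ksubsets_def)
  have "edge_weight r t p H v e \<le> (\<Sum>T\<in>ksubsets e t. vcoeff p v T * 1)"
    unfolding edge_weight_def using b assms(4)
    by (intro sum_mono mult_left_mono powr_slope_le_1) (auto simp: vcoeff_def)
  moreover have "0 \<le> edge_weight r t p H v e"
    unfolding edge_weight_def using assms(4)
    by (intro sum_nonneg mult_nonneg_nonneg powr_slope_nonneg) (auto simp: vcoeff_def)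
  ultimately show ?thesis using sum_vcoeff_le[OF e(3,2) assms(4), where t = t and v = v] by simp
qed

lemma lin_degree_eq_weights:
  assumes "t \<le> r" "r \<le> card (verts H)"
  shows "lin_degree t p H v = powr_slope p (real ((card (verts H) - t) choose (r - t)))
    * (\<Sum>e | e \<in> edges H \<and> v \<in> e. edge_weight r t p H v e)"
proof -
  define N where "N = real ((card (verts H) - t) choose (r - t))"
  have N: "N > 0" using assms by (simp add: N_def zero_less_binomial)
  have "powr_slope p (real (deg H T)) = powr_slope p N * powr_slope p (rel_deg r t H T)" for T
    using powr_slope_mult[of N "rel_deg r t H T" p] N by (simp add: rel_deg_def N_def)
  then show ?thesis
    unfolding lin_degree_def edge_weight_def N_def[symmetric]
    by (simp add: sum_distrib_left mult_ac)
qed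

text \<open>Both degrees are measured in the scale of \<open>exdeg_tp_eq\<close>. The degree in
  \<open>H\<close> is at most the linearized one, typicality passes it to \<open>S\<close>, lowering
  the slopes to those at \<open>x T\<close> costs \<open>\<omega>\<close> per unit of coefficient,
  and the lower tangent estimate returns to a true degree in the sample.\<close>

lemma tp_degree_typical_ge:
  assumes H: "rgraph r H" and t: "t < r" and p: "p \<ge> 1"
    and S: "S \<in> ksubsets (verts H) k" "r \<le> k"
    and ty: "typical r t p \<eta> H S"
    and \<eta>: "\<eta> \<ge> 0" "(real r - real t) / (real k - real t) \<le> \<eta>" "\<omega> \<ge> 0"
    and \<omega>: "\<And>u x. 0 \<le> x \<Longrightarrow> u - 2 * \<eta> \<le> x \<Longrightarrow> u \<le> 1 \<Longrightarrow> 0 \<le> u \<Longrightarrow> powr_slope p u - \<omega> \<le> powr_slope p x"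
    and v: "v \<in> S"
  shows "(tp_degree t p H v / (powr_slope p (real ((card (verts H) - t) choose (r - t))) * real ((card (verts H) - 1) choose (r - 1)))
      - p * real (r choose t) * (\<eta> + \<omega>))
      * (powr_slope p (real ((k - t) choose (r - t))) * real ((k - 1) choose (r - 1)))
    \<le> tp_degree t p (induced H S) v"
proof -
  note fin = rgraphD[OF H]
  have S': "S \<subseteq> verts H" "card S = k" "finite S" using ksubsetsD[OF fin(1) S(1)] by auto
  define n where "n = card (verts H)"
  define N N' C C' M where "N = real ((n - t) choose (r - t))" and "N' = real ((k - t) choose (r - t))"
    and "C = real ((n - 1) choose (r - 1))" and "C' = real ((k - 1) choose (r - 1))"
    and "M = p * real (r choose t)"
  have kn: "k \<le> n" using S' fin(1) card_mono by (auto simp: n_def)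
  have pos: "N > 0" "N' > 0" "C > 0" "C' > 0" "M \<ge> 0"
    using S(2) kn t p by (auto simp: N_def N'_def C_def C'_def M_def zero_less_binomial)
  have slope_pos: "powr_slope p N > 0" using pos by (simp add: powr_slope_def)
  have IS: "rgraph r (induced H S)" using H S'(3) by (auto simp: rgraph_def)
  have u: "0 \<le> rel_deg r t H T" "rel_deg r t H T \<le> 1" if "T \<in> ksubsets S t" for T
    using rel_deg_bounds[OF H, of T t] that S'(1) t by (auto simp: ksubsets_def)
  \<comment> \<open>One \<open>\<eta>\<close> covers the sampling error of the degree of
    \<open>T\<close>, the other the edges lost with \<open>v\<close>. Truncation at 0 keeps
    \<open>x T\<close> in the range where slopes are monotone.\<close>
  define x where "x = (\<lambda>T. N' * max 0 (rel_deg r t H T - 2 * \<eta>))"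
  have x_le: "0 \<le> x T \<and> x T \<le> real (if v \<in> T then deg (induced H S) T else deg (del_vertex (induced H S) v) T)"
    if T: "T \<in> ksubsets (verts (induced H S)) t" for T
  proof
    show "0 \<le> x T" using pos by (simp add: x_def)
    have T': "T \<in> ksubsets S t" using T by simp
    have d: "(rel_deg r t H T - \<eta>) * N' \<le> real (deg (induced H S) T)"
      using ty T' S'(2) by (auto simp: typical_def N'_def)
    show "x T \<le> real (if v \<in> T then deg (induced H S) T else deg (del_vertex (induced H S) v) T)"
    proof (cases "rel_deg r t H T \<le> 2 * \<eta>")
      case True
      then show ?thesis by (simp add: x_def)
    next
      case False
      then have x: "x T = (rel_deg r t H T - \<eta>) * N' - \<eta> * N'" by (simp add: x_def algebra_simps)
      show ?thesis
      proof (cases "v \<in> T")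
        case True
        have "0 \<le> \<eta> * N'" using \<eta>(1) pos by simp
        then show ?thesis using x d True by simp
      next
        case False
        have "insert v T \<in> ksubsets (verts (induced H S)) (Suc t)"
          using ksubsetsD[OF S'(3) T'] False v by (auto simp: ksubsets_def)
        then have "deg (induced H S) (insert v T) \<le> (k - Suc t) choose (r - Suc t)"
          using deg_le[OF IS _ Suc_leI[OF t]] S'(2) by simp
        then have le: "real (deg (induced H S) (insert v T)) \<le> real ((k - Suc t) choose (r - Suc t))"
          by simp
        \<comment> \<open>The number of possible edges through both \<open>T\<close> and
          \<open>v\<close> is the fraction \<open>(r - t) / (k - t)\<close> of \<open>N'\<close>,
          the number through \<open>T\<close>.\<close>
        have "(r - t) * ((k - t) choose (r - t)) = (k - t) * ((k - t - 1) choose (r - t - 1))"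
          using times_binomial_minus1_eq[of "r - t" "k - t"] t by simp
        then have "real (r - t) * N' = real (k - t) * real ((k - Suc t) choose (r - Suc t))"
          unfolding N'_def by (metis of_nat_mult diff_Suc_eq_diff_pred diff_commute diff_diff_left plus_1_eq_Suc add.commute)
        then have "real ((k - Suc t) choose (r - Suc t)) = (real r - real t) / (real k - real t) * N'"
          using t S(2) by (simp add: of_nat_diff field_simps)
        also have "\<dots> \<le> \<eta> * N'" using \<eta>(2) pos by (intro mult_right_mono) auto
        finally have "real (deg (induced H S) (insert v T)) \<le> \<eta> * N'" using le by simp
        moreover have "deg (induced H S) T = deg (del_vertex (induced H S) v) T + deg (induced H S) (insert v T)"
          using deg_split[OF rgraphD(2)[OF IS], of T v] by (simp add: deg_def)
        ultimately show ?thesis using False x d by simp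
      qed
    qed
  qed
  have fE: "finite {e. e \<in> edges H \<and> v \<in> e \<and> e \<subseteq> S}" using fin(2) by simp
  have eS: "card e = r" "finite e" if "e \<in> edges H" for e
    using ksubsetsD[OF fin(1) fin(3)[OF that]] by auto
  have cE: "real (card {e. e \<in> edges H \<and> v \<in> e \<and> e \<subseteq> S}) \<le> C'"
  proof -
    have "{v} \<in> ksubsets (verts (induced H S)) 1" using v by (simp add: ksubsets_def)
    then have "deg (induced H S) {v} \<le> (k - 1) choose (r - 1)"
      using deg_le[OF IS] S'(2) t by simp
    moreover have "deg (induced H S) {v} = card {e. e \<in> edges H \<and> v \<in> e \<and> e \<subseteq> S}"
      unfolding deg_def by (intro arg_cong[where f = card]) auto
    ultimately show ?thesis by (simp add: C'_def)
  qed
  have W: "(tp_degree t p H v / (powr_slope p N * C) - M * \<eta>) * C'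
      \<le> (\<Sum>e | e \<in> edges H \<and> v \<in> e \<and> e \<subseteq> S. edge_weight r t p H v e)"
  proof -
    have "tp_degree t p H v \<le> powr_slope p N * (\<Sum>e | e \<in> edges H \<and> v \<in> e. edge_weight r t p H v e)"
      using tp_degree_le_lin_degree[OF H _ p, of v t] lin_degree_eq_weights[of t r H p v] v S'(1) t kn S(2)
      by (auto simp: N_def n_def)
    then have "tp_degree t p H v / (powr_slope p N * C)
        \<le> (\<Sum>e | e \<in> edges H \<and> v \<in> e. edge_weight r t p H v e) / C"
      using slope_pos pos by (simp add: field_simps)
    then have "(tp_degree t p H v / (powr_slope p N * C) - M * \<eta>) * C'
        \<le> ((\<Sum>e | e \<in> edges H \<and> v \<in> e. edge_weight r t p H v e) / C - M * \<eta>) * C'"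
      using pos by (intro mult_right_mono) auto
    also have "\<dots> \<le> (\<Sum>e | e \<in> edges H \<and> v \<in> e \<and> e \<subseteq> S. edge_weight r t p H v e)"
      using ty v S'(2) by (simp add: typical_def C_def C'_def M_def n_def)
    finally show ?thesis .
  qed
  have "(tp_degree t p H v / (powr_slope p N * C) - M * (\<eta> + \<omega>)) * (powr_slope p N' * C')
      = powr_slope p N' * ((tp_degree t p H v / (powr_slope p N * C) - M * \<eta>) * C' - M * \<omega> * C')"
    by (simp add: algebra_simps)
  \<comment> \<open>The loss \<open>M * \<omega>\<close> is charged to each edge at \<open>v\<close>
    inside \<open>S\<close>, of which there are at most \<open>C'\<close>.\<close>
  also have "\<dots> \<le> powr_slope p N' * ((\<Sum>e | e \<in> edges H \<and> v \<in> e \<and> e \<subseteq> S. edge_weight r t p H v e)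
      - M * \<omega> * real (card {e. e \<in> edges H \<and> v \<in> e \<and> e \<subseteq> S}))"
    using W cE pos \<eta>(3) by (intro mult_left_mono diff_mono powr_slope_nonneg) auto
  also have "\<dots> = powr_slope p N' * (\<Sum>e | e \<in> edges H \<and> v \<in> e \<and> e \<subseteq> S. edge_weight r t p H v e - M * \<omega>)"
    by (simp add: sum_subtractf mult_ac)
  also have "\<dots> \<le> powr_slope p N' * (\<Sum>e | e \<in> edges H \<and> v \<in> e \<and> e \<subseteq> S.
      \<Sum>T\<in>ksubsets e t. vcoeff p v T * powr_slope p (max 0 (rel_deg r t H T - 2 * \<eta>)))"
  proof (intro mult_left_mono sum_mono powr_slope_nonneg)
    fix e assume "e \<in> {e. e \<in> edges H \<and> v \<in> e \<and> e \<subseteq> S}"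
    then have e: "e \<in> edges H" "e \<subseteq> S" by auto
    have "edge_weight r t p H v e - M * \<omega> \<le> edge_weight r t p H v e - (\<Sum>T\<in>ksubsets e t. vcoeff p v T) * \<omega>"
      using sum_vcoeff_le[OF eS(2,1)[OF e(1)] p, where t = t and v = v] \<eta>(3) by (simp add: M_def mult_right_mono)
    also have "\<dots> = (\<Sum>T\<in>ksubsets e t. vcoeff p v T * (powr_slope p (rel_deg r t H T) - \<omega>))"
      by (simp add: edge_weight_def right_diff_distrib sum_subtractf sum_distrib_right)
    also have "\<dots> \<le> (\<Sum>T\<in>ksubsets e t. vcoeff p v T * powr_slope p (max 0 (rel_deg r t H T - 2 * \<eta>)))"
    proof (intro sum_mono mult_left_mono \<omega>)
      fix T assume "T \<in> ksubsets e t"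
      then have T: "T \<in> ksubsets S t" using e(2) by (auto simp: ksubsets_def)
      show "rel_deg r t H T \<le> 1" "0 \<le> rel_deg r t H T" using u[OF T] by auto
      show "0 \<le> vcoeff p v T" using p by (simp add: vcoeff_def)
    qed auto
    finally show "edge_weight r t p H v e - M * \<omega>
      \<le> (\<Sum>T\<in>ksubsets e t. vcoeff p v T * powr_slope p (max 0 (rel_deg r t H T - 2 * \<eta>)))" .
  qed
  also have "\<dots> = (\<Sum>e | e \<in> edges (induced H S) \<and> v \<in> e. \<Sum>T\<in>ksubsets e t. vcoeff p v T * powr_slope p (x T))"
    unfolding sum_distrib_left x_def using pos
    by (intro sum.cong) (auto simp: powr_slope_mult)
  also have "\<dots> \<le> tp_degree t p (induced H S) v"
    by (rule tp_degree_ge[OF IS _ p x_le]) (use v in auto)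
  finally show ?thesis by (simp only: N_def N'_def C_def C'_def M_def n_def)
qed


subsection \<open>Failure probabilities\<close>

lemma choose_mult_power_le:
  assumes "a \<le> r" "r \<le> k"
  shows "real (k choose a) * (1 + real (k - a)) ^ (r - a) \<le> (1 + real k) ^ (2 * r)"
proof -
  have "real (k choose a) \<le> real (k ^ a)" using binomial_le_pow[of a k] assms by (simp only: of_nat_le_iff)
  also have "\<dots> \<le> (1 + real k) ^ a" by (simp add: power_mono)
  also have "\<dots> \<le> (1 + real k) ^ r" using assms by (intro power_increasing) auto
  finally have 1: "real (k choose a) \<le> (1 + real k) ^ r" .
  have "(1 + real (k - a)) ^ (r - a) \<le> (1 + real k) ^ (r - a)" by (intro power_mono) auto
  also have "\<dots> \<le> (1 + real k) ^ r" by (intro power_increasing) auto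
  finally have "real (k choose a) * (1 + real (k - a)) ^ (r - a) \<le> (1 + real k) ^ r * (1 + real k) ^ r"
    using 1 by (intro mult_mono) auto
  then show ?thesis by (simp add: power_add[symmetric] mult_2)
qed

text \<open>The 2 stands for the two clauses of \<open>typical\<close>. The power
  \<open>2 * r\<close> absorbs, for every \<open>a \<le> r\<close>, both the
  \<open>k choose a\<close> of the union bound and the polynomial factor of the tail bound.\<close>

definition atypical_bound :: "nat \<Rightarrow> real \<Rightarrow> nat \<Rightarrow> real" where
  "atypical_bound r \<eta> k = 2 * ((1 + real k) ^ (2 * r) * exp (- (\<eta>\<^sup>2 * (real k - real r) / 2)))"

lemma card_link_failures_le:
  fixes w :: "'a set \<Rightarrow> 'a set \<Rightarrow> real"
  assumes "finite V" "a \<le> r" "r \<le> k" "\<eta> \<ge> 0"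
    and "\<And>A B. A \<in> ksubsets V a \<Longrightarrow> B \<in> ksubsets (V - A) (r - a) \<Longrightarrow> 0 \<le> w A B \<and> w A B \<le> 1"
  shows "real (card {S \<in> ksubsets V k. \<exists>A\<in>ksubsets S a. (\<Sum>B\<in>ksubsets (S - A) (r - a). w A B)
      < ((\<Sum>B\<in>ksubsets (V - A) (r - a). w A B) / real ((card V - a) choose (r - a)) - real r * \<eta>) * real ((k - a) choose (r - a))})
    \<le> real (card V choose k) * (atypical_bound r \<eta> k / 2)" (is "real (card ?F) \<le> _")
proof -
  let ?G = "{S \<in> ksubsets V k. \<exists>A\<in>ksubsets S a. (\<Sum>B\<in>ksubsets (S - A) (r - a). w A B)
      < ((\<Sum>B\<in>ksubsets (V - A) (r - a). w A B) / real ((card V - a) choose (r - a)) - real (r - a) * \<eta>) * real ((k - a) choose (r - a))}"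
  \<comment> \<open>Loosening \<open>r - a\<close> to \<open>r\<close> gives both clauses of
    \<open>typical\<close> the same deviation.\<close>
  have le: "(D - real r * \<eta>) * real c \<le> (D - real (r - a) * \<eta>) * real c" for D c
    using assms(4) by (intro mult_right_mono diff_left_mono) auto
  have "?F \<subseteq> ?G" using le by (blast intro: less_le_trans)
  then have "real (card ?F) \<le> real (card ?G)"
    using assms(1) by (simp add: card_mono)
  also have "\<dots> \<le> real (card V choose k) * (real (k choose a) *
        ((1 + real (k - a)) ^ (r - a) * exp (- (\<eta>\<^sup>2 * (real (k - a) - real (r - a)) / 2))))"
    using assms by (intro sampling_link_lower_tail) auto
  also have "real (k - a) - real (r - a) = real k - real r"
    using assms by (simp add: of_nat_diff)
  also have "real (card V choose k) * (real (k choose a) *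
        ((1 + real (k - a)) ^ (r - a) * exp (- (\<eta>\<^sup>2 * (real k - real r) / 2))))
      \<le> real (card V choose k) * (atypical_bound r \<eta> k / 2)"
    using mult_right_mono[OF choose_mult_power_le[OF assms(2,3)], of "exp (- (\<eta>\<^sup>2 * (real k - real r) / 2))"]
    by (intro mult_left_mono) (auto simp: atypical_bound_def mult.assoc)
  finally show ?thesis .
qed

text \<open>Two instances of the link bound: edge indicators for \<open>a = t\<close>, and edge
  weights at a vertex for \<open>a = 1\<close>, divided by their maximum \<open>M\<close> so as to
  lie in \<open>[0, 1]\<close>.\<close>

lemma card_not_typical_le:
  assumes H: "rgraph r H" and t: "1 \<le> t" "t < r" and p: "p \<ge> 1" and k: "r \<le> k" and \<eta>: "\<eta> \<ge> 0"
  shows "real (card {S \<in> ksubsets (verts H) k. \<not> typical r t p (real r * \<eta>) H S})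
    \<le> real (card (verts H) choose k) * atypical_bound r \<eta> k"
proof -
  note fin = rgraphD[OF H]
  define V M where "V = verts H" and "M = p * real (r choose t)"
  have M: "M > 0" using p t by (simp add: M_def zero_less_binomial)
  define w1 where "w1 = (\<lambda>A B. if A \<union> B \<in> edges H then 1 else 0 :: real)"
  define w2 where "w2 = (\<lambda>A B. if A \<union> B \<in> edges H then edge_weight r t p H (the_elem A) (A \<union> B) / M else 0)"
  define fails where "fails = (\<lambda>w a S. \<exists>A\<in>ksubsets S a. (\<Sum>B\<in>ksubsets (S - A) (r - a). w A B)
      < ((\<Sum>B\<in>ksubsets (V - A) (r - a). w A B) / real ((card V - a) choose (r - a)) - real r * \<eta>) * real ((k - a) choose (r - a)))"
  have fV: "finite V" using fin(1) by (simp add: V_def)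
  have c1: "real (card {S \<in> ksubsets V k. fails w1 t S}) \<le> real (card V choose k) * (atypical_bound r \<eta> k / 2)"
    unfolding fails_def using t k \<eta> fV by (intro card_link_failures_le) (auto simp: w1_def)
  have c2: "real (card {S \<in> ksubsets V k. fails w2 1 S}) \<le> real (card V choose k) * (atypical_bound r \<eta> k / 2)"
    unfolding fails_def using t k \<eta> fV
  proof (intro card_link_failures_le)
    fix A B
    show "0 \<le> w2 A B \<and> w2 A B \<le> 1"
      using edge_weight_bounds[OF H, of "A \<union> B" t p "the_elem A"] t p M
      by (auto simp: w2_def M_def)
  qed auto
  have "typical r t p (real r * \<eta>) H S" if S: "S \<in> ksubsets V k" and n1: "\<not> fails w1 t S" and n2: "\<not> fails w2 1 S" for S
    unfolding typical_def
  proof (intro conjI ballI)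
    have S': "S \<subseteq> V" "card S = k" using S by (auto simp: ksubsets_def)
    {
      fix T assume T: "T \<in> ksubsets S t"
      then have TV: "T \<in> ksubsets V t" using S' by (auto simp: ksubsets_def)
      have "(\<Sum>B\<in>ksubsets (S - T) (r - t). w1 T B) = real (deg (induced H S) T)"
        unfolding w1_def deg_induced using sum_edges_link[OF H _ T, of "\<lambda>_. 1"] t S' by (simp add: V_def)
      moreover have "(\<Sum>B\<in>ksubsets (V - T) (r - t). w1 T B) = real (deg H T)"
        using sum_edges_link[OF H _ TV, of "\<lambda>_. 1"] t deg_induced[of H V T] induced_verts[OF H]
        by (simp add: V_def w1_def)
      ultimately show "(rel_deg r t H T - real r * \<eta>) * real ((card S - t) choose (r - t)) \<le> real (deg (induced H S) T)"
        using n1 T S' by (auto simp: fails_def rel_deg_def V_def not_less)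
    next
      fix v assume v: "v \<in> S"
      then have A: "{v} \<in> ksubsets S 1" "{v} \<in> ksubsets V 1" using S' by (auto simp: ksubsets_def)
      define W where "W = edge_weight r t p H v"
      have w2: "w2 {v} = (\<lambda>B. if {v} \<union> B \<in> edges H then W ({v} \<union> B) / M else 0)"
        by (simp only: w2_def W_def the_elem_eq)
      have "(\<Sum>B\<in>ksubsets (S - {v}) (r - 1). w2 {v} B) = (\<Sum>e | e \<in> edges H \<and> {v} \<subseteq> e \<and> e \<subseteq> S. W e / M)"
        using sum_edges_link[OF H _ A(1), of "\<lambda>e. W e / M"] t S' by (simp add: w2 V_def)
      then have sS: "(\<Sum>B\<in>ksubsets (S - {v}) (r - 1). w2 {v} B) = (\<Sum>e | e \<in> edges H \<and> v \<in> e \<and> e \<subseteq> S. W e) / M"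
        by (simp add: sum_divide_distrib)
      have "(\<Sum>B\<in>ksubsets (V - {v}) (r - 1). w2 {v} B) = (\<Sum>e | e \<in> edges H \<and> {v} \<subseteq> e \<and> e \<subseteq> V. W e / M)"
        using sum_edges_link[OF H _ A(2), of "\<lambda>e. W e / M"] t by (simp add: w2 V_def)
      also have "{e. e \<in> edges H \<and> {v} \<subseteq> e \<and> e \<subseteq> V} = {e. e \<in> edges H \<and> v \<in> e}"
        using H by (auto simp: rgraph_def V_def)
      finally have sV: "(\<Sum>B\<in>ksubsets (V - {v}) (r - 1). w2 {v} B) = (\<Sum>e | e \<in> edges H \<and> v \<in> e. W e) / M"
        by (simp add: sum_divide_distrib)
      have "((\<Sum>e | e \<in> edges H \<and> v \<in> e. W e) / M / real ((card V - 1) choose (r - 1)) - real r * \<eta>) * real ((k - 1) choose (r - 1))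
        \<le> (\<Sum>e | e \<in> edges H \<and> v \<in> e \<and> e \<subseteq> S. W e) / M"
        using n2 A(1) by (simp only: fails_def not_less Set.bex_simps Set.ball_simps not_le sS[symmetric] sV[symmetric])
      then have "M * (((\<Sum>e | e \<in> edges H \<and> v \<in> e. W e) / M / real ((card V - 1) choose (r - 1)) - real r * \<eta>) * real ((k - 1) choose (r - 1)))
        \<le> (\<Sum>e | e \<in> edges H \<and> v \<in> e \<and> e \<subseteq> S. W e)"
        using M by (simp add: le_divide_eq mult.commute)
      moreover have "M * (((\<Sum>e | e \<in> edges H \<and> v \<in> e. W e) / M / real ((card V - 1) choose (r - 1)) - real r * \<eta>) * real ((k - 1) choose (r - 1)))
        = ((\<Sum>e | e \<in> edges H \<and> v \<in> e. W e) / real ((card V - 1) choose (r - 1)) - M * (real r * \<eta>)) * real ((k - 1) choose (r - 1))"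
        using M by (simp add: algebra_simps)
      ultimately show "((\<Sum>e | e \<in> edges H \<and> v \<in> e. edge_weight r t p H v e) / real ((card (verts H) - 1) choose (r - 1))
          - p * real (r choose t) * (real r * \<eta>)) * real ((card S - 1) choose (r - 1))
        \<le> (\<Sum>e | e \<in> edges H \<and> v \<in> e \<and> e \<subseteq> S. edge_weight r t p H v e)"
        by (simp only: W_def V_def M_def S'(2))
    }
  qed
  then have "{S \<in> ksubsets V k. \<not> typical r t p (real r * \<eta>) H S}
      \<subseteq> {S \<in> ksubsets V k. fails w1 t S} \<union> {S \<in> ksubsets V k. fails w2 1 S}" by blast
  then have "card {S \<in> ksubsets V k. \<not> typical r t p (real r * \<eta>) H S}
      \<le> card ({S \<in> ksubsets V k. fails w1 t S} \<union> {S \<in> ksubsets V k. fails w2 1 S})"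
    using fV by (intro card_mono) auto
  also have "\<dots> \<le> card {S \<in> ksubsets V k. fails w1 t S} + card {S \<in> ksubsets V k. fails w2 1 S}"
    by (rule card_Un_le)
  finally have "real (card {S \<in> ksubsets V k. \<not> typical r t p (real r * \<eta>) H S})
      \<le> real (card {S \<in> ksubsets V k. fails w1 t S}) + real (card {S \<in> ksubsets V k. fails w2 1 S})"
    by linarith
  also have "\<dots> \<le> real (card V choose k) * atypical_bound r \<eta> k" using c1 c2 by simp
  finally show ?thesis by (simp only: V_def)
qed

lemma power_le_fact_mult_exp:
  fixes y :: real
  assumes "y \<ge> 0"
  shows "y ^ m \<le> fact m * exp y"
proof -
  have "(\<Sum>n\<in>{m}. y ^ n /\<^sub>R fact n) \<le> (\<Sum>n. y ^ n /\<^sub>R fact n)"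
    using assms by (intro sum_le_suminf summable_exp_generic) auto
  also have "\<dots> = exp y" using exp_converges[of y] by (simp add: sums_iff)
  finally show ?thesis by (simp add: field_simps)
qed

lemma summable_atypical_bound:
  assumes "\<eta> > 0"
  shows "summable (atypical_bound r \<eta>)"
proof -
  \<comment> \<open>Half of the decay rate \<open>\<eta>^2 / 2 = 2 * c\<close> is spent on the
    polynomial factor; the other half leaves a geometric series.\<close>
  define c where "c = \<eta>\<^sup>2 / 4"
  have c: "c > 0" using assms by (simp add: c_def)
  define C where "C = 2 * fact (2 * r) / c ^ (2 * r) * exp (c + 2 * c * real r)"
  have "norm (atypical_bound r \<eta> k) \<le> C * exp (- c) ^ k" for k
  proof -
    have "c ^ (2 * r) * (1 + real k) ^ (2 * r) \<le> fact (2 * r) * exp (c * (1 + real k))"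
      using power_le_fact_mult_exp[of "c * (1 + real k)" "2 * r"] c by (simp add: power_mult_distrib)
    then have "(1 + real k) ^ (2 * r) \<le> fact (2 * r) / c ^ (2 * r) * exp (c * (1 + real k))"
      using c by (simp add: field_simps)
    then have "atypical_bound r \<eta> k
        \<le> 2 * (fact (2 * r) / c ^ (2 * r) * exp (c * (1 + real k)) * exp (- (\<eta>\<^sup>2 * (real k - real r) / 2)))"
      unfolding atypical_bound_def by (intro mult_left_mono mult_right_mono) auto
    also have "\<dots> = 2 * fact (2 * r) / c ^ (2 * r) * exp (c * (1 + real k) + - (\<eta>\<^sup>2 * (real k - real r) / 2))"
      by (simp only: exp_add)
    also have "c * (1 + real k) + - (\<eta>\<^sup>2 * (real k - real r) / 2) = (c + 2 * c * real r) + real k * (- c)"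
      by (simp add: c_def field_simps)
    also have "exp \<dots> = exp (c + 2 * c * real r) * exp (- c) ^ k"
      by (simp only: exp_add exp_of_nat_mult)
    finally have "atypical_bound r \<eta> k \<le> C * exp (- c) ^ k" by (simp add: C_def)
    moreover have "atypical_bound r \<eta> k \<ge> 0" by (simp add: atypical_bound_def)
    ultimately show ?thesis by simp
  qed
  moreover have "summable (\<lambda>k. C * exp (- c) ^ k)"
    using c by (intro summable_mult summable_geometric) simp
  ultimately show ?thesis by (rule summable_comparison_test'[where N = 0, rotated])
qed

text \<open>Count pairs of a \<open>k\<close>-set and one of its points whose deletion lands in
  \<open>F\<close>: each counted \<open>k\<close>-set gives \<open>k\<close> pairs, each member of
  \<open>F\<close> at most \<open>card V - (k - 1)\<close>, and the binomial coefficients have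
  exactly this ratio. So proportions do not grow.\<close>

lemma card_all_deletions_in_le:
  assumes "finite V" "F \<subseteq> ksubsets V (k - 1)" "0 < k" "k \<le> card V"
    and "real (card F) \<le> real (card V choose (k - 1)) * \<beta>"
  shows "real (card {S \<in> ksubsets V k. \<forall>x\<in>S. S - {x} \<in> F}) \<le> real (card V choose k) * \<beta>"
proof -
  let ?G = "{S \<in> ksubsets V k. \<forall>x\<in>S. S - {x} \<in> F}"
  have fF: "finite F" using assms(1,2) finite_subset finite_ksubsets by blast
  have "real k * real (card ?G) = (\<Sum>S\<in>?G. \<Sum>x\<in>S. of_bool (S - {x} \<in> F))"
    by (simp add: ksubsets_def mult.commute)
  also have "\<dots> \<le> (\<Sum>S\<in>ksubsets V k. \<Sum>x\<in>S. of_bool (S - {x} \<in> F))"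
    using assms(1) by (intro sum_mono2 sum_nonneg) auto
  also have "\<dots> = (\<Sum>x\<in>V. \<Sum>B\<in>ksubsets (V - {x}) (k - 1). of_bool (B \<in> F))"
    by (rule sum_ksubsets_split_point[OF assms(1,3)])
  also have "\<dots> = (\<Sum>x\<in>V. \<Sum>B | B \<in> F \<and> x \<notin> B. 1)"
  proof (rule sum.cong[OF refl])
    fix x assume "x \<in> V"
    have "ksubsets (V - {x}) (k - 1) \<inter> {B. B \<in> F} = {B. B \<in> F \<and> x \<notin> B}"
      using assms(2) by (auto simp: ksubsets_def)
    then show "(\<Sum>B\<in>ksubsets (V - {x}) (k - 1). of_bool (B \<in> F)) = (\<Sum>B | B \<in> F \<and> x \<notin> B. 1 :: real)"
      using assms(1) by (simp add: sum_of_bool_eq)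
  qed
  also have "\<dots> = (\<Sum>B\<in>F. \<Sum>x | x \<in> V \<and> x \<notin> B. 1)"
    using assms(1) fF by (intro sum.swap_restrict)
  also have "\<dots> = (\<Sum>B\<in>F. real (card V - (k - 1)))"
  proof (intro sum.cong refl)
    fix B assume "B \<in> F"
    moreover have "{x. x \<in> V \<and> x \<notin> B} = V - B" by auto
    ultimately show "(\<Sum>x | x \<in> V \<and> x \<notin> B. 1) = real (card V - (k - 1))"
      using card_Diff_ksubsets[OF assms(1), of B "k - 1"] assms(2) by auto
  qed
  also have "\<dots> = real (card V - (k - 1)) * real (card F)" by simp
  also have "\<dots> \<le> real (card V - (k - 1)) * (real (card V choose (k - 1)) * \<beta>)"
    using assms(5) by (intro mult_left_mono) auto
  also have "\<dots> = real ((card V - (k - 1)) * (card V choose (k - 1))) * \<beta>" by simp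
  also have "(card V - (k - 1)) * (card V choose (k - 1)) = k * (card V choose k)"
    using binomial_absorb_comp[of "card V" "k - 1"] times_binomial_minus1_eq[OF assms(3), of "card V"] by simp
  finally have "real k * real (card ?G) \<le> real k * (real (card V choose k) * \<beta>)" by (simp add: mult.assoc)
  then show ?thesis using assms(3) by (simp del: of_nat_mult)
qed

text \<open>Union bound: each set in \<open>D\<close> lies in
  \<open>(card V - r) choose (m - r)\<close> sets of size \<open>m\<close>.\<close>

lemma card_ksubsets_meeting_le:
  assumes "finite V" "D \<subseteq> ksubsets V r" "r \<le> m"
  shows "real (card {S \<in> ksubsets V m. \<exists>d\<in>D. d \<subseteq> S}) \<le> real (card D) * real ((card V - r) choose (m - r))"
proof -
  have "{S \<in> ksubsets V m. \<exists>d\<in>D. d \<subseteq> S} = {S \<in> ksubsets V m. \<exists>A\<in>ksubsets S r. A \<in> D}"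
    using assms(2) by (auto simp: ksubsets_def)
  then have "real (card {S \<in> ksubsets V m. \<exists>d\<in>D. d \<subseteq> S}) = (\<Sum>S\<in>ksubsets V m. of_bool (\<exists>A\<in>ksubsets S r. A \<in> D))"
    using assms(1) by (simp add: sum_of_bool_eq Int_def)
  also have "\<dots> \<le> (\<Sum>S\<in>ksubsets V m. \<Sum>A\<in>ksubsets S r. of_bool (A \<in> D))"
  proof (rule sum_mono)
    fix S assume "S \<in> ksubsets V m"
    then have "finite S" using ksubsetsD[OF assms(1)] by blast
    then have fin: "finite (ksubsets S r)" by simp
    show "of_bool (\<exists>A\<in>ksubsets S r. A \<in> D) \<le> (\<Sum>A\<in>ksubsets S r. of_bool (A \<in> D) :: real)"
    proof (cases "\<exists>A\<in>ksubsets S r. A \<in> D")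
      case True
      then obtain A where A: "A \<in> ksubsets S r" "A \<in> D" by blast
      then have "(1 :: real) = of_bool (A \<in> D)" by simp
      also have "\<dots> \<le> (\<Sum>A\<in>ksubsets S r. of_bool (A \<in> D))"
        using fin A by (intro member_le_sum) auto
      finally show ?thesis using True by simp
    qed (simp add: sum_nonneg)
  qed
  also have "\<dots> = (\<Sum>A\<in>ksubsets V r. \<Sum>B\<in>ksubsets (V - A) (m - r). of_bool (A \<in> D))"
    by (rule sum_ksubsets_split[OF assms(1,3)])
  also have "\<dots> = (\<Sum>A\<in>ksubsets V r. of_bool (A \<in> D) * real ((card V - r) choose (m - r)))"
    using assms(1) card_Diff_ksubsets[OF assms(1)] by (intro sum.cong refl) (simp add: card_ksubsets)
  also have "\<dots> = real (card D) * real ((card V - r) choose (m - r))"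
  proof -
    have "ksubsets V r \<inter> {A. A \<in> D} = D" using assms(2) by auto
    then show ?thesis using assms(1) by (simp add: sum_distrib_right[symmetric] sum_of_bool_eq)
  qed
  finally show ?thesis .
qed

section \<open>Choice of the constants and induction on the sample size\<close>

theorem theorem3p10:
  fixes r t :: nat and p :: real and \<F> \<H> :: "hgraph set"
  assumes "t \<ge> 1" and "r > t" and "p \<ge> 1"
    and "\<forall>G\<in>\<F>. rgraph r G"
    and "nondegenerate r \<F>"
    and "\<forall>H\<in>\<H>. rgraph r H \<and> free_of \<F> H"
    and "hereditary r \<H>"
    and "edge_stable r t p \<F> \<H>"
    and "vertex_extendable r t p \<F> \<H>"
  shows "degree_stable r t p \<F> \<H>"
proof (cases "\<exists>k. free_rgraphs r \<F> k = {}")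
  case True
  \<comment> \<open>Without free graphs of some order there are none of any larger order, and
    degree-stability is vacuous.\<close>
  then obtain k where "\<forall>n\<ge>k. free_rgraphs r \<F> n = {}" using free_rgraphs_empty_mono by metis
  then show ?thesis unfolding degree_stable_def by (intro exI[of _ 1] conjI exI[of _ k]) auto
next
  case False
  then have ne: "\<And>n. free_rgraphs r \<F> n \<noteq> {}" by blast
  have t: "1 \<le> t" "t < r" and p: "p \<ge> 1" using assms(1-3) by auto
  obtain L where L: "L > 0" "tp_density r t p \<F> \<longlonglongrightarrow> L" "\<And>n. n \<ge> r \<Longrightarrow> L \<le> tp_density r t p \<F> n"
    using tp_density_limit_pos[OF ne t(2) p assms(5)] by blast
  obtain \<epsilon>0' N0 where ext: "\<epsilon>0' > 0" "\<And>n H. n \<ge> N0 \<Longrightarrow> H \<in> free_rgraphs r \<F> n \<Longrightarrow>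
      min_tp_degree t p H \<ge> (1 - \<epsilon>0') * exdeg_tp r t p \<F> n \<Longrightarrow> \<exists>v\<in>verts H. del_vertex H v \<in> \<H> \<Longrightarrow> H \<in> \<H>"
    using assms(9) unfolding vertex_extendable_def by metis
  \<comment> \<open>The cap at 1 makes \<open>1 - \<epsilon>0\<close> nonnegative, so that
    inequalities may be multiplied by it.\<close>
  define \<epsilon>0 where "\<epsilon>0 = min \<epsilon>0' 1"
  have \<epsilon>0: "\<epsilon>0 > 0" "\<epsilon>0 \<le> 1" "\<epsilon>0 \<le> \<epsilon>0'" using ext(1) by (auto simp: \<epsilon>0_def)
  define c where "c = real t + p * (real r - real t)"
  define K where "K = c * real (r choose t) / real r"
  define M where "M = p * real (r choose t)"
  have c: "c > 0" using t p by (simp add: c_def add_pos_nonneg)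
  have K: "K > 0" using c t by (simp add: K_def zero_less_binomial)
  have M: "M > 0" using p t by (simp add: M_def zero_less_binomial)
  \<comment> \<open>Chosen so that the total sampling loss \<open>2 * M * \<theta>\<close> equals
    \<open>K * L * \<epsilon>0 / 4\<close>. The passage from density \<open>L\<close> to order
    \<open>k\<close> and the slack \<open>\<epsilon>\<close> cost a further quarter each.\<close>
  define \<theta> where "\<theta> = K * L * \<epsilon>0 / (8 * M)"
  have \<theta>: "\<theta> > 0" using K L \<epsilon>0 M by (simp add: \<theta>_def)
  obtain h where h: "h > 0"
    "\<And>u x. 0 \<le> x \<Longrightarrow> u - h \<le> x \<Longrightarrow> u \<le> 1 \<Longrightarrow> 0 \<le> u \<Longrightarrow> powr_slope p u - \<theta> \<le> powr_slope p x"
    using powr_slope_uniform[OF p \<theta>] by blast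
  \<comment> \<open>The half accounts for the drop \<open>2 * \<eta>1\<close> in relative degrees.
    The division by \<open>r\<close> that follows undoes the factor \<open>r\<close> in
    \<open>card_not_typical_le\<close>.\<close>
  define \<eta>1 where "\<eta>1 = min (h / 2) \<theta>"
  define \<eta> where "\<eta> = \<eta>1 / real r"
  have \<eta>: "\<eta>1 > 0" "\<eta>1 \<le> \<theta>" "2 * \<eta>1 \<le> h" "\<eta> > 0" "real r * \<eta> = \<eta>1"
    using h(1) \<theta> t by (auto simp: \<eta>1_def \<eta>_def)

  obtain m1 where m1: "\<And>k. k \<ge> m1 \<Longrightarrow> tp_density r t p \<F> k \<le> L * (1 + \<epsilon>0 / 4)"
  proof -
    have "L < L * (1 + \<epsilon>0 / 4)" using L \<epsilon>0 by simp
    then have "eventually (\<lambda>k. tp_density r t p \<F> k < L * (1 + \<epsilon>0 / 4)) sequentially"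
      by (rule order_tendstoD[OF L(2)])
    then show ?thesis using that by (auto simp: eventually_sequentially intro: less_imp_le)
  qed
  obtain m2 where m2: "\<And>n. n \<ge> m2 \<Longrightarrow> norm (sum (atypical_bound r \<eta>) {m2..<n}) < 1 / 2"
  proof -
    have "\<exists>N. \<forall>m\<ge>N. \<forall>n. norm (sum (atypical_bound r \<eta>) {m..<n}) < 1 / 2"
      using summable_atypical_bound[OF \<eta>(4), of r] unfolding summable_Cauchy
      by (elim allE[of _ "1 / 2"]) simp
    then show ?thesis using that by blast
  qed
  \<comment> \<open>From here on the share of a \<open>t\<close>-set's degree that is lost with one
    vertex is at most \<open>\<eta>1\<close>.\<close>
  obtain m3 where m3: "real m3 \<ge> real t + (real r - real t) / \<eta>1"
    using real_arch_simple by blast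
  define m where "m = Max {N0, m1, m2, m3, Suc r}"
  have m: "N0 \<le> m" "m1 \<le> m" "m2 \<le> m" "m3 \<le> m" "Suc r \<le> m"
    unfolding m_def by (auto intro: Max_ge)
  have ratio: "(real r - real t) / (real k - real t) \<le> \<eta>1" if "k \<ge> m" for k
  proof -
    have "(real r - real t) / \<eta>1 \<le> real k - real t" using m3 m(4) that by linarith
    then show ?thesis using \<eta>(1) t m(5) that by (simp add: field_simps)
  qed
  have tail: "(\<Sum>i\<in>{m<..n}. atypical_bound r \<eta> i) < 1 / 2" for n
  proof -
    have "(\<Sum>i\<in>{m<..n}. atypical_bound r \<eta> i) \<le> sum (atypical_bound r \<eta>) {m2..<max m2 (Suc n)}"
      using m(3) by (intro sum_mono2) (auto simp: atypical_bound_def)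
    also have "\<dots> < 1 / 2" using m2[of "max m2 (Suc n)"] by simp
    finally show ?thesis .
  qed

  \<comment> \<open>With \<open>n ^ r \<le> r ^ r * (n choose r)\<close>, at most
    \<open>\<delta> * n ^ r\<close> deleted edges meet at most half of the \<open>m\<close>-sets, in
    the sense of lying inside them.\<close>
  define \<delta> where "\<delta> = 1 / (2 * real r ^ r * real (m choose r))"
  have mr: "real (m choose r) > 0" using m(5) by (simp add: zero_less_binomial)
  have \<delta>: "\<delta> > 0" using mr t by (simp add: \<delta>_def)
  obtain \<epsilon>1 N1 where es: "\<epsilon>1 > 0" "\<And>n H. n \<ge> N1 \<Longrightarrow> H \<in> free_rgraphs r \<F> n \<Longrightarrow>
      tp_norm t p H \<ge> (1 - \<epsilon>1) * ex_tp r t p \<F> n \<Longrightarrow>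
      \<exists>D\<subseteq>edges H. real (card D) \<le> \<delta> * real n ^ r \<and> HGraph (verts H) (edges H - D) \<in> \<H>"
    using assms(8) \<delta> unfolding edge_stable_def by metis
  define \<epsilon> where "\<epsilon> = min (\<epsilon>0 / 4) \<epsilon>1"
  have \<epsilon>: "\<epsilon> > 0" "\<epsilon> \<le> \<epsilon>0 / 4" "\<epsilon> \<le> \<epsilon>1" using \<epsilon>0 es(1) by (auto simp: \<epsilon>_def)
  have ex0: "ex_tp r t p \<F> n \<ge> 0" for n
    using ex_tp_attained[OF ne[of n]] tp_norm_nonneg by metis

  have main: "H \<in> \<H>" if n: "n \<ge> max m N1" and H: "H \<in> free_rgraphs r \<F> n"
    and deg: "min_tp_degree t p H \<ge> (1 - \<epsilon>) * exdeg_tp r t p \<F> n" for n H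
  proof -
    have H': "rgraph r H" "card (verts H) = n" using H by (auto simp: free_rgraphs_def)
    note fin = rgraphD[OF H'(1)]
    define V where "V = verts H"
    have V: "finite V" "card V = n" using fin H' by (auto simp: V_def)
    have nm: "m \<le> n" "N1 \<le> n" "n > 0" "r \<le> n" using n m(5) by auto

    \<comment> \<open>The factor \<open>c\<close> in \<open>exdeg_tp\<close> and in the average of
      linearized degrees is the same, so it cancels.\<close>
    have "c * ((1 - \<epsilon>1) * ex_tp r t p \<F> n) \<le> c * ((1 - \<epsilon>) * ex_tp r t p \<F> n)"
      using c \<epsilon>(3) ex0 by (intro mult_left_mono mult_right_mono) auto
    also have "\<dots> = real n * ((1 - \<epsilon>) * exdeg_tp r t p \<F> n)"
      using nm(3) by (simp add: exdeg_tp_def c_def)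
    also have "\<dots> \<le> real n * min_tp_degree t p H" using deg by (intro mult_left_mono) auto
    also have "\<dots> \<le> c * tp_norm t p H"
      using card_mult_min_tp_degree_le[OF H'(1) _ p, of t] t H'(2) by (simp add: c_def)
    finally have "tp_norm t p H \<ge> (1 - \<epsilon>1) * ex_tp r t p \<F> n" using c by simp
    then obtain D where D: "D \<subseteq> edges H" "real (card D) \<le> \<delta> * real n ^ r" "HGraph V (edges H - D) \<in> \<H>"
      using es(2)[OF nm(2) H] unfolding V_def by blast

    define bad where "bad = (\<lambda>k. {S \<in> ksubsets V k. induced H S \<notin> \<H>})"

    have init: "real (card (bad m)) \<le> real (n choose m) * (1 / 2)"
    proof -
      have DV: "D \<subseteq> ksubsets V r" using D(1) fin(3) by (auto simp: V_def)
      have "bad m \<subseteq> {S \<in> ksubsets V m. \<exists>d\<in>D. d \<subseteq> S}"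
      proof
        fix S assume S: "S \<in> bad m"
        then have S': "S \<subseteq> V" "finite S" using ksubsetsD[OF V(1)] by (auto simp: bad_def)
        have "\<exists>d\<in>D. d \<subseteq> S"
        proof (rule ccontr)
          assume "\<not> (\<exists>d\<in>D. d \<subseteq> S)"
          then have "subgraph (induced H S) (HGraph V (edges H - D))"
            using S' by (auto simp: subgraph_def)
          moreover have "rgraph r (induced H S)" using H'(1) S' by (auto simp: rgraph_def)
          ultimately have "induced H S \<in> \<H>" using assms(7) D(3) unfolding hereditary_def by blast
          then show False using S by (simp add: bad_def)
        qed
        then show "S \<in> {S \<in> ksubsets V m. \<exists>d\<in>D. d \<subseteq> S}" using S by (simp add: bad_def)
      qed
      then have "real (card (bad m)) \<le> real (card {S \<in> ksubsets V m. \<exists>d\<in>D. d \<subseteq> S})"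
        using V(1) by (simp add: card_mono)
      also have "\<dots> \<le> real (card D) * real ((n - r) choose (m - r))"
        using card_ksubsets_meeting_le[OF V(1) DV, of m] m(5) V(2) by simp
      also have "\<dots> \<le> (\<delta> * (real r ^ r * real (n choose r))) * real ((n - r) choose (m - r))"
      proof (intro mult_right_mono)
        have "(real n / real r) ^ r \<le> real (n choose r)"
          using binomial_ge_n_over_k_pow_k[OF nm(4), where 'a = real] by simp
        then have "real n ^ r \<le> real r ^ r * real (n choose r)"
          using t by (simp add: power_divide field_simps)
        then have "\<delta> * real n ^ r \<le> \<delta> * (real r ^ r * real (n choose r))"
          using \<delta> by (intro mult_left_mono) auto
        then show "real (card D) \<le> \<delta> * (real r ^ r * real (n choose r))" using D(2) by linarith
      qed simp
      also have "\<dots> = \<delta> * real r ^ r * real ((n choose r) * ((n - r) choose (m - r)))" by simp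
      also have "(n choose r) * ((n - r) choose (m - r)) = (n choose m) * (m choose r)"
        using choose_times_choose[of r m n] m(5) by simp
      also have "\<delta> * real r ^ r * real ((n choose m) * (m choose r)) = real (n choose m) * (1 / 2)"
        using mr t by (simp add: \<delta>_def)
      finally show ?thesis .
    qed

    have good: "induced H S \<in> \<H>"
      if S: "S \<in> ksubsets V k" "m \<le> k" and ty: "typical r t p (real r * \<eta>) H S"
        and x: "x \<in> S" "S - {x} \<notin> bad (k - 1)" for S k x
    proof -
      have S': "S \<subseteq> V" "card S = k" "finite S" using ksubsetsD[OF V(1) S(1)] by auto
      have rk: "r \<le> k" using S(2) m(5) by simp
      have kn: "k \<le> n" using card_mono[OF V(1) S'(1)] S'(2) V(2) by simp
      define X where "X = (\<lambda>k. powr_slope p (real ((k - t) choose (r - t))) * real ((k - 1) choose (r - 1)))"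
      have X: "X i > 0" if "r \<le> i" for i
        using that t by (auto simp: X_def powr_slope_def zero_less_binomial)
      have exdeg: "exdeg_tp r t p \<F> i = K * tp_density r t p \<F> i * X i" if "r \<le> i" for i
        using exdeg_tp_eq[of r t i p \<F>] that t by (simp add: K_def c_def X_def)
      have "(1 - \<epsilon>0) * exdeg_tp r t p \<F> k \<le> tp_degree t p (induced H S) v" if v: "v \<in> S" for v
      proof -
        have "(1 - \<epsilon>) * (K * tp_density r t p \<F> n * X n) \<le> tp_degree t p H v"
          using deg min_tp_degree_le[OF fin(1), of v t p] v S'(1) exdeg[OF nm(4)] by (auto simp: V_def)
        then have dv: "(1 - \<epsilon>) * (K * tp_density r t p \<F> n) \<le> tp_degree t p H v / X n"
          using X[OF nm(4)] by (simp add: le_divide_eq mult.assoc)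
        have "(1 - \<epsilon>0) * (K * tp_density r t p \<F> k) \<le> (1 - \<epsilon>0) * (K * (L * (1 + \<epsilon>0 / 4)))"
          using \<epsilon>0 K m1[of k] m(2) S(2) by (intro mult_left_mono) auto
        also have "\<dots> = K * L * ((1 - \<epsilon>0) * (1 + \<epsilon>0 / 4))" by (simp add: mult_ac)
        \<comment> \<open>The product is at most \<open>1 - \<epsilon>0 / 2\<close>; one quarter is
          kept for \<open>\<epsilon>\<close>, the other is the sampling loss.\<close>
        also have "\<dots> \<le> K * L * ((1 - \<epsilon>0 / 4) - \<epsilon>0 / 4)"
        proof (rule mult_left_mono)
          have "(1 - \<epsilon>0 / 4) - \<epsilon>0 / 4 - (1 - \<epsilon>0) * (1 + \<epsilon>0 / 4) = \<epsilon>0 / 4 + \<epsilon>0 * \<epsilon>0 / 4"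
            by (simp add: field_simps)
          moreover have "\<epsilon>0 / 4 + \<epsilon>0 * \<epsilon>0 / 4 \<ge> 0" using \<epsilon>0 by simp
          ultimately show "(1 - \<epsilon>0) * (1 + \<epsilon>0 / 4) \<le> (1 - \<epsilon>0 / 4) - \<epsilon>0 / 4" by linarith
        qed (use K L in simp)
        also have "\<dots> = (1 - \<epsilon>0 / 4) * (K * L) - M * (\<theta> + \<theta>)"
          using M by (simp add: \<theta>_def field_simps)
        also have "\<dots> \<le> (1 - \<epsilon>) * (K * tp_density r t p \<F> n) - M * (\<eta>1 + \<theta>)"
          using \<epsilon> \<epsilon>0 K L(1) L(3)[OF nm(4)] M \<eta>(2)
          by (intro diff_mono mult_mono mult_left_mono) auto
        also have "\<dots> \<le> tp_degree t p H v / X n - M * (\<eta>1 + \<theta>)" using dv by simp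
        finally have "(1 - \<epsilon>0) * (K * tp_density r t p \<F> k) * X k \<le> (tp_degree t p H v / X n - M * (\<eta>1 + \<theta>)) * X k"
          using X[OF rk] by (intro mult_right_mono) auto
        also have "\<dots> \<le> tp_degree t p (induced H S) v"
          using tp_degree_typical_ge[OF H'(1) t(2) p S(1)[unfolded V_def] rk ty[unfolded \<eta>(5)], of \<theta> v]
            \<eta>(1,3) ratio[OF S(2)] \<theta> v h(2) H'(2)
          by (simp add: X_def M_def)
        finally show ?thesis by (simp add: exdeg[OF rk] mult.assoc)
      qed
      moreover have "exdeg_tp r t p \<F> k \<ge> 0"
        using ex0[of k] c by (simp add: exdeg_tp_def c_def)
      then have "(1 - \<epsilon>0') * exdeg_tp r t p \<F> k \<le> (1 - \<epsilon>0) * exdeg_tp r t p \<F> k"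
        using \<epsilon>0(3) by (intro mult_right_mono) auto
      ultimately have "(1 - \<epsilon>0') * exdeg_tp r t p \<F> k \<le> tp_degree t p (induced H S) v" if "v \<in> S" for v
        using that by force
      then have "(1 - \<epsilon>0') * exdeg_tp r t p \<F> k \<le> min_tp_degree t p (induced H S)"
        unfolding min_tp_degree_def using S'(3) x(1) by (subst Min_ge_iff) auto
      moreover have "induced H S \<in> free_rgraphs r \<F> k"
        using induced_free_rgraphs[OF H] S(1) by (simp add: V_def)
      moreover have "S - {x} \<in> ksubsets V (k - 1)" using S' x(1) by (auto simp: ksubsets_def)
      then have "del_vertex (induced H S) x \<in> \<H>"
        using x(2) by (simp add: bad_def del_vertex_induced)
      ultimately show ?thesis using ext(2)[of k "induced H S"] m(1) S(2) x(1) by auto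
    qed

    have increment: "real (card (bad k)) \<le> real (n choose k) * (\<beta> + atypical_bound r \<eta> k)"
      if k: "m < k" "k \<le> n" and \<beta>: "real (card (bad (k - 1))) \<le> real (n choose (k - 1)) * \<beta>" for k \<beta>
    proof -
      define A B where "A = {S \<in> ksubsets V k. \<not> typical r t p (real r * \<eta>) H S}"
        and "B = {S \<in> ksubsets V k. \<forall>x\<in>S. S - {x} \<in> bad (k - 1)}"
      have "bad k \<subseteq> A \<union> B"
      proof
        \<comment> \<open>A typical set with even one deletion outside \<open>bad (k - 1)\<close> is
          good, so a typical bad set has only bad deletions.\<close>
        fix S assume "S \<in> bad k"
        then show "S \<in> A \<union> B" using good[of S k] k(1) by (auto simp: bad_def A_def B_def)
      qed
      moreover have "finite (A \<union> B)" using V(1) by (simp add: A_def B_def)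
      ultimately have "card (bad k) \<le> card (A \<union> B)" by (intro card_mono)
      also have "\<dots> \<le> card A + card B" by (rule card_Un_le)
      finally have "real (card (bad k)) \<le> real (card A) + real (card B)" by linarith
      moreover have "real (card A) \<le> real (n choose k) * atypical_bound r \<eta> k"
        unfolding A_def V_def using card_not_typical_le[OF H'(1) t p, of k \<eta>] m(5) k \<eta>(4) H'(2) by simp
      moreover have "real (card B) \<le> real (n choose k) * \<beta>"
        unfolding B_def using card_all_deletions_in_le[OF V(1), of "bad (k - 1)" k \<beta>] k \<beta> V(2)
        by (auto simp: bad_def)
      ultimately show ?thesis by (simp add: distrib_left)
    qed

    have "real (card (bad k)) \<le> real (n choose k) * (1 / 2 + (\<Sum>i\<in>{m<..k}. atypical_bound r \<eta> i))"
      if "m \<le> k" "k \<le> n" for k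
      using that
    proof (induction k rule: dec_induct)
      case base
      then show ?case using init by simp
    next
      case (step k)
      have "{m<..Suc k} = insert (Suc k) {m<..k}" using step.hyps by auto
      then show ?case
        using increment[of "Suc k" "1 / 2 + (\<Sum>i\<in>{m<..k}. atypical_bound r \<eta> i)"] step
        by (simp del: binomial_Suc_Suc add: add_ac)
    qed
    \<comment> \<open>As \<open>n choose n = 1\<close>, the proportion is the cardinality itself: at
      most 1/2 from the start plus a tail below 1/2.\<close>
    from this[OF nm(1) order_refl] have "real (card (bad n)) < 1" using tail[of n] by simp
    then have "bad n = {}" using V(1) by (simp add: bad_def)
    moreover have "V \<in> ksubsets V n" using V by (simp add: ksubsets_def)
    ultimately have "induced H V \<in> \<H>" by (auto simp: bad_def)
    then show ?thesis using induced_verts[OF H'(1)] by (simp add: V_def)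
  qed
  show ?thesis unfolding degree_stable_def
    using \<epsilon>(1) main by (intro exI[of _ \<epsilon>] conjI exI[of _ "max m N1"]) auto
qed

end
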